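(* Let $\mathcal{D}$ be either $(\mathbb{Z},<,=)$ or $(\mathbb{N},<,=)$. Consider the restriction of the CLTL realizability problem over $\mathcal{D}$ to instances in which the system owns exactly one variable $y$, which is a look-ahead variable, and the environment owns exactly one look-ahead variable $x$ together with an arbitrary finite set $W$ of future-blind variables (the size of $W$ is not bounded; it is part of the input). This restricted problem (given the CLTL formula $\phi$ and the variable partition, decide whether the system has a winning strategy in the CLTL game with winning condition $\phi$) is undecidable.
   Context: A constraint system is $\mathcal{D}=(D,R_1,\dots,R_n,\mathcal{I})$ with $D$ a nonempty domain and each predicate symbol $R_i$ of arity $a_i$ interpreted as $\mathcal{I}(R_i)\subseteq D^{a_i}$; in $(\mathbb{Z},<,=)$ and $(\mathbb{N},<,=)$ the symbols $<,=$ have their usual meaning. A finite set of variables $V$ is partitioned into look-ahead variables $V^a$ and future-blind variables $V^b$. A look-ahead term is $X^i y$ with $y\in V^a$, $i\ge 0$. A constraint is $R(t_1,\dots,t_n)$ where either all $t_j$ are future-blind variables or all $t_j$ are look-ahead terms. CLTL formulas: $\phi ::= c \mid \lnot\phi \mid \phi\lor\phi \mid X\phi \mid \phi U\phi$ with $c$ a constraint. A concrete model is a sequence $\sigma=\sigma(0)\sigma(1)\cdots$ of mappings $\sigma(i)\colon V\to D$. Semantics: $\sigma,i\models R(X^{i_1}x_1,\dots,X^{i_n}x_n)$ iff $(\sigma(i+i_1)(x_1),\dots,\sigma(i+i_n)(x_n))\in\mathcal{I}(R)$; for future-blind $x_1,\dots,x_n$, $\sigma,i\models R(x_1,\dots,x_n)$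 iff $(\sigma(i)(x_1),\dots,\sigma(i)(x_n))\in\mathcal{I}(R)$; Boolean connectives, $X$ (next) and $U$ (until) as in LTL; $F$, $G$ are the usual abbreviations. CLTL game: $V$ is partitioned into $\mathit{SV}$ (system) and $\mathit{EV}$ (environment). In each round $i=0,1,\dots$ the environment picks $\mathit{em}_i\colon\mathit{EV}\to D$, then the system (knowing all previous choices and $\mathit{em}_i$) picks $\mathit{sm}_i\colon\mathit{SV}\to D$; the play yields the concrete model $\sigma$ with $\sigma(i)=\mathit{em}_i\oplus\mathit{sm}_i$ (the union of the two mappings). A system strategy is a function from finite sequences of mappings $V\to D$ followed by a mapping $\mathit{EV}\to D$ to mappings $\mathit{SV}\to D$; it is winning if every play consistent with it yields $\sigma$ with $\sigma,0\models\phi$. The realizability problem asks, given $\phi$, whether the system has a winning strategy. *)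

theory Defs
  imports Main "HOL-Library.Nat_Bijection"
begin

section \<open>Constraint systems and CLTL\<close>

text \<open>The (nonempty) domain of a constraint system is the type \<open>'d\<close>; a relation of arity \<open>n\<close> is a
  set of lists of length \<open>n\<close>.\<close>

record ('r, 'd) constraint_system =
  arity :: "'r \<Rightarrow> nat"
  interp :: "'r \<Rightarrow> 'd list set"

datatype order_symbol = Less | Equal

definition order_system :: "(order_symbol, 'd::linorder) constraint_system" where
  "order_system =
    \<lparr> arity = (\<lambda>_. 2),
      interp = (\<lambda>R. case R of
          Less \<Rightarrow> {[a, b] | a b. a < b}
        | Equal \<Rightarrow> {[a, b] | a b. a = b}) \<rparr>"

text \<open>\<open>Blind R [x\<^sub>1, \<dots>, x\<^sub>n]\<close> is the constraint \<open>R(x\<^sub>1, \<dots>, x\<^sub>n)\<close> over future-blind variables, and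
  \<open>Look R [(i\<^sub>1, x\<^sub>1), \<dots>, (i\<^sub>n, x\<^sub>n)]\<close> is the constraint over the look-ahead terms
  \<open>X\<close>-to-the-\<open>i\<^sub>j\<close> of \<open>x\<^sub>j\<close>.\<close>

datatype ('r, 'v) cltl =
    Blind 'r "'v list"
  | Look 'r "(nat \<times> 'v) list"
  | Neg "('r, 'v) cltl"
  | Or "('r, 'v) cltl" "('r, 'v) cltl"
  | Next "('r, 'v) cltl"
  | Until "('r, 'v) cltl" "('r, 'v) cltl"

primrec wf_cltl :: "('r, 'd) constraint_system \<Rightarrow> 'v set \<Rightarrow> 'v set \<Rightarrow> ('r, 'v) cltl \<Rightarrow> bool" where
  "wf_cltl \<D> Va Vb (Blind R xs) \<longleftrightarrow> length xs = arity \<D> R \<and> set xs \<subseteq> Vb"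
| "wf_cltl \<D> Va Vb (Look R ts) \<longleftrightarrow> length ts = arity \<D> R \<and> snd ` set ts \<subseteq> Va"
| "wf_cltl \<D> Va Vb (Neg \<phi>) \<longleftrightarrow> wf_cltl \<D> Va Vb \<phi>"
| "wf_cltl \<D> Va Vb (Or \<phi> \<psi>) \<longleftrightarrow> wf_cltl \<D> Va Vb \<phi> \<and> wf_cltl \<D> Va Vb \<psi>"
| "wf_cltl \<D> Va Vb (Next \<phi>) \<longleftrightarrow> wf_cltl \<D> Va Vb \<phi>"
| "wf_cltl \<D> Va Vb (Until \<phi> \<psi>) \<longleftrightarrow> wf_cltl \<D> Va Vb \<phi> \<and> wf_cltl \<D> Va Vb \<psi>"

text \<open>A mapping from a set \<open>A\<close> of variables to the domain is a partial map with domain \<open>A\<close>. The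
  underspecified value \<open>the None\<close> below is never reached for a well-formed formula and a model
  that assigns a value to every variable of the formula.\<close>

primrec sat :: "('r, 'd) constraint_system \<Rightarrow> (nat \<Rightarrow> 'v \<rightharpoonup> 'd) \<Rightarrow> nat \<Rightarrow> ('r, 'v) cltl \<Rightarrow> bool" where
  "sat \<D> \<sigma> i (Blind R xs) \<longleftrightarrow> map (\<lambda>x. the (\<sigma> i x)) xs \<in> interp \<D> R"
| "sat \<D> \<sigma> i (Look R ts) \<longleftrightarrow> map (\<lambda>(j, x). the (\<sigma> (i + j) x)) ts \<in> interp \<D> R"
| "sat \<D> \<sigma> i (Neg \<phi>) \<longleftrightarrow> \<not> sat \<D> \<sigma> i \<phi>"
| "sat \<D> \<sigma> i (Or \<phi> \<psi>) \<longleftrightarrow> sat \<D> \<sigma> i \<phi> \<or> sat \<D> \<sigma> i \<psi>"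
| "sat \<D> \<sigma> i (Next \<phi>) \<longleftrightarrow> sat \<D> \<sigma> (Suc i) \<phi>"
| "sat \<D> \<sigma> i (Until \<phi> \<psi>) \<longleftrightarrow>
    (\<exists>j\<ge>i. sat \<D> \<sigma> j \<psi> \<and> (\<forall>k. i \<le> k \<and> k < j \<longrightarrow> sat \<D> \<sigma> k \<phi>))"

section \<open>CLTL games and realizability\<close>

record ('r, 'v) cltl_game =
  sys_vars :: "'v set"
  env_vars :: "'v set"
  lookahead_vars :: "'v set"
  blind_vars :: "'v set"
  goal :: "('r, 'v) cltl"

definition wf_game :: "('r, 'd) constraint_system \<Rightarrow> ('r, 'v) cltl_game \<Rightarrow> bool" where
  "wf_game \<D> G \<longleftrightarrow>
    finite (sys_vars G \<union> env_vars G) \<and>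
    sys_vars G \<inter> env_vars G = {} \<and>
    lookahead_vars G \<inter> blind_vars G = {} \<and>
    lookahead_vars G \<union> blind_vars G = sys_vars G \<union> env_vars G \<and>
    wf_cltl \<D> (lookahead_vars G) (blind_vars G) (goal G)"

type_synonym ('v, 'd) strategy = "('v \<rightharpoonup> 'd) list \<Rightarrow> ('v \<rightharpoonup> 'd) \<Rightarrow> ('v \<rightharpoonup> 'd)"

definition system_strategy :: "('r, 'v) cltl_game \<Rightarrow> ('v, 'd) strategy \<Rightarrow> bool" where
  "system_strategy G s \<longleftrightarrow>
    (\<forall>h em. (\<forall>m \<in> set h. dom m = sys_vars G \<union> env_vars G) \<and> dom em = env_vars G
      \<longrightarrow> dom (s h em) = sys_vars G)"

definition consistent :: "('r, 'v) cltl_game \<Rightarrow> ('v, 'd) strategy \<Rightarrow> (nat \<Rightarrow> 'v \<rightharpoonup> 'd) \<Rightarrow> bool" where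
  "consistent G s \<sigma> \<longleftrightarrow>
    (\<exists>em. \<forall>i. dom (em i) = env_vars G \<and> \<sigma> i = em i ++ s (map \<sigma> [0..<i]) (em i))"

definition realizable :: "('r, 'd) constraint_system \<Rightarrow> ('r, 'v) cltl_game \<Rightarrow> bool" where
  "realizable \<D> G \<longleftrightarrow>
    (\<exists>s :: ('v, 'd) strategy. system_strategy G s \<and>
      (\<forall>\<sigma>. consistent G s \<sigma> \<longrightarrow> sat \<D> \<sigma> 0 (goal G)))"

text \<open>Well-formedness forces \<open>x \<noteq> y\<close> and \<open>x, y \<notin> W\<close>.\<close>

definition restricted_game :: "('r, 'd) constraint_system \<Rightarrow> ('r, 'v) cltl_game \<Rightarrow> bool" where
  "restricted_game \<D> G \<longleftrightarrow>
    wf_game \<D> G \<and>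
    (\<exists>x y W. finite W \<and> sys_vars G = {y} \<and> env_vars G = insert x W \<and>
      lookahead_vars G = {x, y} \<and> blind_vars G = W)"

section \<open>Decidability\<close>

datatype recf =
    Zero
  | Succ
  | Proj nat
  | Comp recf "recf list"
  | Prec recf recf
  | Mu recf

text \<open>Partial recursive functions; \<open>None\<close> stands for divergence.\<close>

fun rec_eval :: "recf \<Rightarrow> nat list \<Rightarrow> nat option" where
  "rec_eval Zero xs = Some 0"
| "rec_eval Succ xs = (case xs of [x] \<Rightarrow> Some (Suc x) | _ \<Rightarrow> None)"
| "rec_eval (Proj i) xs = (if i < length xs then Some (xs ! i) else None)"
| "rec_eval (Comp f gs) xs =
    (case those (map (\<lambda>g. rec_eval g xs) gs) of None \<Rightarrow> None | Some ys \<Rightarrow> rec_eval f ys)"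
| "rec_eval (Prec f g) xs =
    (case xs of
      [] \<Rightarrow> None
    | n # ys \<Rightarrow>
        rec_nat (rec_eval f ys)
          (\<lambda>m r. case r of None \<Rightarrow> None | Some v \<Rightarrow> rec_eval g (m # v # ys)) n)"
| "rec_eval (Mu f) xs =
    (if \<exists>n. rec_eval f (n # xs) = Some 0 \<and> (\<forall>m<n. rec_eval f (m # xs) \<noteq> None)
     then Some (LEAST n. rec_eval f (n # xs) = Some 0)
     else None)"

text \<open>A decision problem consists of instances \<open>P\<close>, encoded by \<open>enc\<close>, and yes-instances \<open>Q\<close>. The
  behaviour of a decision procedure is only constrained on codes of instances.\<close>

definition decidable_on :: "('a \<Rightarrow> nat) \<Rightarrow> ('a \<Rightarrow> bool) \<Rightarrow> ('a \<Rightarrow> bool) \<Rightarrow> bool" where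
  "decidable_on enc P Q \<longleftrightarrow>
    (\<exists>f. \<forall>a. P a \<longrightarrow> rec_eval f [enc a] = Some (if Q a then 1 else 0))"

primrec encode_symbol :: "order_symbol \<Rightarrow> nat" where
  "encode_symbol Less = 0"
| "encode_symbol Equal = 1"

primrec encode_cltl :: "(order_symbol, nat) cltl \<Rightarrow> nat" where
  "encode_cltl (Blind R xs) = prod_encode (0, prod_encode (encode_symbol R, list_encode xs))"
| "encode_cltl (Look R ts) =
    prod_encode (1, prod_encode (encode_symbol R, list_encode (map prod_encode ts)))"
| "encode_cltl (Neg \<phi>) = prod_encode (2, encode_cltl \<phi>)"
| "encode_cltl (Or \<phi> \<psi>) = prod_encode (3, prod_encode (encode_cltl \<phi>, encode_cltl \<psi>))"
| "encode_cltl (Next \<phi>) = prod_encode (4, encode_cltl \<phi>)"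
| "encode_cltl (Until \<phi> \<psi>) = prod_encode (5, prod_encode (encode_cltl \<phi>, encode_cltl \<psi>))"

definition encode_game :: "(order_symbol, nat) cltl_game \<Rightarrow> nat" where
  "encode_game G =
    list_encode
      [set_encode (sys_vars G), set_encode (env_vars G),
       set_encode (lookahead_vars G), set_encode (blind_vars G), encode_cltl (goal G)]"

lemma encode_symbol_inject: "encode_symbol R = encode_symbol S \<longleftrightarrow> R = S"
  by (cases R; cases S) auto

lemma encode_cltl_inject: "encode_cltl \<phi> = encode_cltl \<psi> \<Longrightarrow> \<phi> = \<psi>"
proof (induction \<phi> arbitrary: \<psi>)
  case (Blind R xs)
  then show ?case by (cases \<psi>) (auto simp: encode_symbol_inject list_encode_eq)
next
  case (Look R ts)
  then show ?case
    by (cases \<psi>)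
       (auto simp: encode_symbol_inject list_encode_eq inj_map_eq_map[OF inj_prod_encode])
next
  case (Neg \<phi>)
  then show ?case by (cases \<psi>) auto
next
  case (Or \<phi>1 \<phi>2)
  then show ?case by (cases \<psi>) auto
next
  case (Next \<phi>)
  then show ?case by (cases \<psi>) auto
next
  case (Until \<phi>1 \<phi>2)
  then show ?case by (cases \<psi>) auto
qed

lemma inj_on_encode_game: "inj_on encode_game {G. wf_game \<D> G}"
proof (rule inj_onI)
  fix G H :: "(order_symbol, nat) cltl_game"
  assume wf: "G \<in> {G. wf_game \<D> G}" "H \<in> {G. wf_game \<D> G}"
    and eq: "encode_game G = encode_game H"
  have fin: "finite (sys_vars K) \<and> finite (env_vars K) \<and> finite (lookahead_vars K) \<and>
      finite (blind_vars K)" if "wf_game \<D> K" for K :: "(order_symbol, nat) cltl_game"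
    using that unfolding wf_game_def by (metis finite_Un)
  show "G = H"
    using wf fin[of G] fin[of H] eq
    by (intro cltl_game.equality)
       (auto simp: encode_game_def list_encode_eq set_encode_eq dest: encode_cltl_inject)
qed

end

theory Submission
  imports Defs
begin

text \<open>No future-blind variable is needed. The system defends a claim that a recursive function
  \<open>f\<close> maps \<open>xs\<close> to \<open>v\<close>. The numbers of a claim are consecutive values of \<open>y\<close>, and the claim is
  reduced to smaller ones: for a composition the system supplies the intermediate results and the
  environment chooses by \<open>x\<close> which of them is checked; for a primitive recursion the system supplies
  the preceding value and the environment either has the recursion step checked or descends, so
  that an Until formula suffices; for a minimisation the environment names by \<open>x\<close> the argument to be
  checked. The order does not express that \<open>b\<close> is the successor of \<open>a\<close>, but the
  environment refutes a false assertion of this kind by playing a value strictly between them.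
  Hence the system wins exactly if the claim is true. A hypothetical decision procedure is
  turned into a recursive function that returns \<open>0\<close> on the code of the formula which claims that
  this very function returns \<open>0\<close> on this code if and only if this claim is false.\<close>

section \<open>Winning from a history\<close>

definition follows :: "(('a \<times> 'b) list \<Rightarrow> 'a \<Rightarrow> 'b) \<Rightarrow> nat \<Rightarrow> (nat \<Rightarrow> 'a \<times> 'b) \<Rightarrow> bool" where
  "follows S n \<sigma> \<longleftrightarrow> (\<forall>j\<ge>n. snd (\<sigma> j) = S (map \<sigma> [0..<j]) (fst (\<sigma> j)))"

text \<open>A history is the list of rounds already played, so an unfinished play is a game of its
  own and a nested claim can be analysed from its own block on.\<close>

definition win :: "((nat \<Rightarrow> 'a \<times> 'b) \<Rightarrow> bool) \<Rightarrow> ('a \<times> 'b) list \<Rightarrow> bool" where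
  "win P h \<longleftrightarrow>
    (\<exists>S. \<forall>\<sigma>. map \<sigma> [0..<length h] = h \<longrightarrow> follows S (length h) \<sigma> \<longrightarrow> P \<sigma>)"

text \<open>Witnesses that some play extends \<open>h\<close> and follows \<open>S\<close>, whatever
  \<open>S\<close> is. This makes a constantly false condition unwinnable in
  \<open>win_const\<close>.\<close>

fun play :: "('a \<times> 'b) list \<Rightarrow> (('a \<times> 'b) list \<Rightarrow> 'a \<Rightarrow> 'b) \<Rightarrow> nat \<Rightarrow> 'a \<times> 'b" where
  "play h S j =
    (if j < length h then h ! j
     else (undefined, S (map (play h S) [0..<j]) undefined))"

declare play.simps [simp del]

lemma play_extends: "map (play h S) [0..<length h] = h"
  by (rule nth_equalityI) (auto simp: play.simps)

lemma follows_play: "follows S (length h) (play h S)"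
  by (auto simp: follows_def play.simps[of h S])

lemma win_cong:
  assumes "\<And>\<sigma>. map \<sigma> [0..<length h] = h \<Longrightarrow> P \<sigma> \<longleftrightarrow> Q \<sigma>"
  shows "win P h \<longleftrightarrow> win Q h"
  using assms unfolding win_def by blast

lemma win_const: "win (\<lambda>_. c) h \<longleftrightarrow> c"
  using play_extends follows_play unfolding win_def by metis

text \<open>Turns the quantifiers over strategies and plays into quantifiers over single
  moves.\<close>

lemma win_round: "win P h \<longleftrightarrow> (\<forall>x. \<exists>y. win P (h @ [(x, y)]))"
proof
  assume "win P h"
  then obtain S where S: "\<And>\<sigma>. map \<sigma> [0..<length h] = h \<Longrightarrow> follows S (length h) \<sigma> \<Longrightarrow> P \<sigma>"
    unfolding win_def by blast
  have "win P (h @ [(x, S h x)])" for x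
    unfolding win_def
  proof (intro exI allI impI)
    fix \<sigma>
    assume ext: "map \<sigma> [0..<length (h @ [(x, S h x)])] = h @ [(x, S h x)]"
      and fol: "follows S (length (h @ [(x, S h x)])) \<sigma>"
    have h: "map \<sigma> [0..<length h] = h" "\<sigma> (length h) = (x, S h x)"
      using ext by auto
    then have "snd (\<sigma> j) = S (map \<sigma> [0..<j]) (fst (\<sigma> j))" if "j \<ge> length h" for j
      using fol that by (cases "j = length h") (auto simp: follows_def)
    then show "P \<sigma>"
      using S h by (simp add: follows_def)
  qed
  then show "\<forall>x. \<exists>y. win P (h @ [(x, y)])" by blast
next
  assume "\<forall>x. \<exists>y. win P (h @ [(x, y)])"
  then obtain y S where S: "\<And>x \<sigma>. map \<sigma> [0..<Suc (length h)] = h @ [(x, y x)] \<Longrightarrow>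
      follows (S x) (Suc (length h)) \<sigma> \<Longrightarrow> P \<sigma>"
    unfolding win_def by simp metis
  \<comment> \<open>The strategies for the different \<open>x\<close> are glued: the history shows
    which \<open>x\<close> was played right after \<open>h\<close>.\<close>
  define T where
    "T h' x = (if length h' = length h then y x else S (fst (h' ! length h)) h' x)" for h' x
  show "win P h"
    unfolding win_def
  proof (intro exI allI impI)
    fix \<sigma>
    assume ext: "map \<sigma> [0..<length h] = h" and fol: "follows T (length h) \<sigma>"
    have "snd (\<sigma> (length h)) = y (fst (\<sigma> (length h)))"
      using fol by (auto simp: follows_def T_def)
    then have "\<sigma> (length h) = (fst (\<sigma> (length h)), y (fst (\<sigma> (length h))))"
      by (metis prod.collapse)
    then have "map \<sigma> [0..<Suc (length h)] = h @ [(fst (\<sigma> (length h)), y (fst (\<sigma> (length h))))]"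
      using ext by simp
    moreover have "follows (S (fst (\<sigma> (length h)))) (Suc (length h)) \<sigma>"
      using fol by (auto simp: follows_def T_def)
    ultimately show "P \<sigma>" by (rule S)
  qed
qed

text \<open>When the outcome does not depend on the environment's moves in these rounds, the system
  loses nothing by fixing its values in advance.\<close>

lemma win_oblivious_rounds:
  assumes "\<And>xs ys. length xs = n \<Longrightarrow> length ys = n \<Longrightarrow> win P (h @ zip xs ys) \<longleftrightarrow> R ys"
  shows "win P h \<longleftrightarrow> (\<exists>ys. length ys = n \<and> R ys)"
  using assms
proof (induction n arbitrary: h R)
  case 0
  then show ?case by simp
next
  case (Suc n)
  have "win P (h @ [(x, y)]) \<longleftrightarrow> (\<exists>ys. length ys = n \<and> R (y # ys))" for x y
  proof (rule Suc.IH)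
    fix xs :: "'a list" and ys :: "'b list"
    assume "length xs = n" "length ys = n"
    then show "win P ((h @ [(x, y)]) @ zip xs ys) \<longleftrightarrow> R (y # ys)"
      using Suc.prems[of "x # xs" "y # ys"] by simp
  qed
  then show ?case
    by (subst win_round) (auto simp: length_Suc_conv)
qed

text \<open>A claim reacts only to the environment's first move in a block, so the system may choose
  its whole block as an answer to that move.\<close>

lemma win_rounds:
  assumes "n > 0"
    and "\<And>xs ys. length xs = n \<Longrightarrow> length ys = n \<Longrightarrow> win P (h @ zip xs ys) \<longleftrightarrow> R (hd xs) ys"
  shows "win P h \<longleftrightarrow> (\<forall>x. \<exists>ys. length ys = n \<and> R x ys)"
proof -
  obtain k where k: "n = Suc k"
    using assms(1) gr0_implies_Suc by blast
  have "win P (h @ [(x, y)]) \<longleftrightarrow> (\<exists>ys. length ys = k \<and> R x (y # ys))" for x y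
  proof (rule win_oblivious_rounds)
    fix xs :: "'a list" and ys :: "'b list"
    assume "length xs = k" "length ys = k"
    then show "win P ((h @ [(x, y)]) @ zip xs ys) \<longleftrightarrow> R x (y # ys)"
      using assms(2)[of "x # xs" "y # ys"] k by simp
  qed
  then have "win P h \<longleftrightarrow> (\<forall>x. \<exists>y ys. length ys = k \<and> R x (y # ys))"
    by (subst win_round) simp
  then show ?thesis
    unfolding k length_Suc_conv by metis
qed

section \<open>Formulas over the variables \<open>x\<close> and \<open>y\<close>\<close>

text \<open>The environment owns variable \<open>0\<close> and the system owns variable \<open>1\<close>; there are no
  future-blind variables. The term \<open>YN L b\<close> is slot \<open>b\<close> of the block after the current one, where
  the current block has \<open>L\<close> rounds.\<close>

type_synonym formula = "(order_symbol, nat) cltl"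

definition X :: "nat \<Rightarrow> nat \<times> nat" where "X j = (j, 0)"
definition Y :: "nat \<Rightarrow> nat \<times> nat" where "Y j = (j, 1)"
definition YN :: "nat \<Rightarrow> nat \<Rightarrow> nat \<times> nat" where "YN L b = (L + b, 1)"

definition lt :: "nat \<times> nat \<Rightarrow> nat \<times> nat \<Rightarrow> formula" where "lt s t = Look Less [s, t]"
definition eq :: "nat \<times> nat \<Rightarrow> nat \<times> nat \<Rightarrow> formula" where "eq s t = Look Equal [s, t]"
definition TT :: formula where "TT = eq (Y 0) (Y 0)"
definition FF :: formula where "FF = Neg TT"
definition Conj :: "formula \<Rightarrow> formula \<Rightarrow> formula" where
  "Conj \<phi> \<psi> = Neg (Or (Neg \<phi>) (Neg \<psi>))"
definition Ite :: "formula \<Rightarrow> formula \<Rightarrow> formula \<Rightarrow> formula" where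
  "Ite b \<phi> \<psi> = Or (Conj b \<phi>) (Conj (Neg b) \<psi>)"
definition Conjs :: "formula list \<Rightarrow> formula" where
  "Conjs \<phi>s = foldr Conj \<phi>s TT"

text \<open>For \<open>a\<close> and \<open>b\<close> below \<open>L\<close>, the environment's move
  \<open>X L\<close> comes after both slots are fixed, so it can still expose a value strictly
  between them.\<close>

definition no_gap :: "nat \<Rightarrow> nat \<Rightarrow> nat \<Rightarrow> formula" where
  "no_gap L a b = Neg (Conj (lt (Y a) (X L)) (lt (X L) (Y b)))"

definition copies :: "nat \<Rightarrow> (nat \<times> nat) list \<Rightarrow> formula" where
  "copies L ab = Conjs (map (\<lambda>(a, b). eq (Y a) (YN L b)) ab)"

text \<open>The marker is handed on and all other slots of the next block lie above it, so that each
  of them represents a number.\<close>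

definition step :: "nat \<Rightarrow> nat \<Rightarrow> formula \<Rightarrow> formula \<Rightarrow> formula" where
  "step L L' c \<psi> =
    Conj (Conjs (eq (Y 0) (YN L 0) # map (\<lambda>j. lt (Y 0) (YN L j)) [1..<L']))
      (Conj c ((Next ^^ L) \<psi>))"

text \<open>Separates block starts from inner rounds: from an inner round, the next marker is less
  than \<open>L\<close> rounds ahead and smaller than the value there.\<close>

definition start :: "nat \<Rightarrow> formula" where
  "start L = Conjs (map (\<lambda>j. lt (Y 0) (Y j)) [1..<L])"

definition model :: "(nat \<Rightarrow> 'd \<times> 'd) \<Rightarrow> nat \<Rightarrow> nat \<rightharpoonup> 'd" where
  "model \<sigma> i = [0 \<mapsto> fst (\<sigma> i), 1 \<mapsto> snd (\<sigma> i)]"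

definition holds :: "(nat \<Rightarrow> 'd::linorder \<times> 'd) \<Rightarrow> nat \<Rightarrow> formula \<Rightarrow> bool" where
  "holds \<sigma> i \<phi> \<longleftrightarrow> sat order_system (model \<sigma>) i \<phi>"

definition val :: "(nat \<Rightarrow> 'd \<times> 'd) \<Rightarrow> nat \<Rightarrow> nat \<times> nat \<Rightarrow> 'd" where
  "val \<sigma> i = (\<lambda>(j, v). the (model \<sigma> (i + j) v))"

lemma val_X: "val \<sigma> i (X j) = fst (\<sigma> (i + j))"
  and val_Y: "val \<sigma> i (Y j) = snd (\<sigma> (i + j))"
  and val_YN: "val \<sigma> i (YN L b) = snd (\<sigma> (i + L + b))"
  by (simp_all add: val_def X_def Y_def YN_def model_def add.assoc)

lemma holds_simps [simp]:
  "holds \<sigma> i (lt s t) \<longleftrightarrow> val \<sigma> i s < val \<sigma> i t"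
  "holds \<sigma> i (eq s t) \<longleftrightarrow> val \<sigma> i s = val \<sigma> i t"
  "holds \<sigma> i TT"
  "\<not> holds \<sigma> i FF"
  "holds \<sigma> i (Neg \<phi>) \<longleftrightarrow> \<not> holds \<sigma> i \<phi>"
  "holds \<sigma> i (Or \<phi> \<psi>) \<longleftrightarrow> holds \<sigma> i \<phi> \<or> holds \<sigma> i \<psi>"
  "holds \<sigma> i (Conj \<phi> \<psi>) \<longleftrightarrow> holds \<sigma> i \<phi> \<and> holds \<sigma> i \<psi>"
  "holds \<sigma> i (Ite b \<phi> \<psi>) \<longleftrightarrow> (if holds \<sigma> i b then holds \<sigma> i \<phi> else holds \<sigma> i \<psi>)"
proof -
  show lt: "holds \<sigma> i (lt s t) \<longleftrightarrow> val \<sigma> i s < val \<sigma> i t"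
    and eq: "holds \<sigma> i (eq s t) \<longleftrightarrow> val \<sigma> i s = val \<sigma> i t" for s t
    by (auto simp: holds_def lt_def eq_def order_system_def val_def)
  show TT: "holds \<sigma> i TT"
    by (simp add: TT_def eq)
  show Neg: "holds \<sigma> i (Neg \<phi>) \<longleftrightarrow> \<not> holds \<sigma> i \<phi>" for \<phi>
    by (simp add: holds_def)
  show Or: "holds \<sigma> i (Or \<phi> \<psi>) \<longleftrightarrow> holds \<sigma> i \<phi> \<or> holds \<sigma> i \<psi>" for \<phi> \<psi>
    by (simp add: holds_def)
  show "\<not> holds \<sigma> i FF"
    by (simp add: FF_def TT Neg)
  show Conj: "holds \<sigma> i (Conj \<phi> \<psi>) \<longleftrightarrow> holds \<sigma> i \<phi> \<and> holds \<sigma> i \<psi>" for \<phi> \<psi>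
    by (simp add: Conj_def Neg Or)
  show "holds \<sigma> i (Ite b \<phi> \<psi>) \<longleftrightarrow> (if holds \<sigma> i b then holds \<sigma> i \<phi> else holds \<sigma> i \<psi>)"
    by (simp add: Ite_def Neg Or Conj)
qed

lemma holds_Conjs [simp]: "holds \<sigma> i (Conjs \<phi>s) \<longleftrightarrow> (\<forall>\<phi>\<in>set \<phi>s. holds \<sigma> i \<phi>)"
  by (induction \<phi>s) (simp_all add: Conjs_def)

lemma holds_NextN [simp]: "holds \<sigma> i ((Next ^^ k) \<phi>) \<longleftrightarrow> holds \<sigma> (i + k) \<phi>"
  by (induction k arbitrary: i) (auto simp: holds_def)

lemma holds_Until:
  "holds \<sigma> i (Until \<phi> \<psi>) \<longleftrightarrow> (\<exists>j\<ge>i. holds \<sigma> j \<psi> \<and> (\<forall>k. i \<le> k \<and> k < j \<longrightarrow> holds \<sigma> k \<phi>))"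
  by (simp add: holds_def)

lemma holds_no_gap:
  "holds \<sigma> i (no_gap L a b) \<longleftrightarrow>
    \<not> (val \<sigma> i (Y a) < fst (\<sigma> (i + L)) \<and> fst (\<sigma> (i + L)) < val \<sigma> i (Y b))"
  by (simp add: no_gap_def val_X)

lemma holds_copies:
  "holds \<sigma> i (copies L ab) \<longleftrightarrow> (\<forall>(a, b)\<in>set ab. val \<sigma> i (Y a) = val \<sigma> i (YN L b))"
  by (auto simp: copies_def)

text \<open>Inner rounds that satisfy \<open>\<phi>\<close> and refute \<open>\<psi>\<close> neither
  end nor break the Until, which therefore unfolds block by block. The premise may assume
  \<open>\<phi>\<close> at \<open>i\<close> because in the loop it is \<open>\<phi>\<close> that
  provides the next marker.\<close>

lemma holds_Until_block:
  assumes "K > 0"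
    and "\<And>k. i < k \<Longrightarrow> k < i + K \<Longrightarrow> holds \<sigma> i \<phi> \<Longrightarrow> holds \<sigma> k \<phi> \<and> \<not> holds \<sigma> k \<psi>"
  shows "holds \<sigma> i (Until \<phi> \<psi>) \<longleftrightarrow>
    holds \<sigma> i \<psi> \<or> holds \<sigma> i \<phi> \<and> holds \<sigma> (i + K) (Until \<phi> \<psi>)"
proof
  assume "holds \<sigma> i (Until \<phi> \<psi>)"
  then obtain j where j: "j \<ge> i" "holds \<sigma> j \<psi>" "\<And>k. i \<le> k \<Longrightarrow> k < j \<Longrightarrow> holds \<sigma> k \<phi>"
    by (auto simp: holds_Until)
  show "holds \<sigma> i \<psi> \<or> holds \<sigma> i \<phi> \<and> holds \<sigma> (i + K) (Until \<phi> \<psi>)"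
  proof (cases "j = i")
    case False
    then have \<phi>: "holds \<sigma> i \<phi>"
      using j by simp
    then have "j \<ge> i + K"
      using assms(2)[of j] j False by (meson le_neq_implies_less not_less)
    then have "holds \<sigma> (i + K) (Until \<phi> \<psi>)"
      unfolding holds_Until using j by (intro exI[of _ j]) auto
    with \<phi> show ?thesis by blast
  qed (use j in simp)
next
  assume "holds \<sigma> i \<psi> \<or> holds \<sigma> i \<phi> \<and> holds \<sigma> (i + K) (Until \<phi> \<psi>)"
  then show "holds \<sigma> i (Until \<phi> \<psi>)"
  proof
    assume "holds \<sigma> i \<phi> \<and> holds \<sigma> (i + K) (Until \<phi> \<psi>)"
    then obtain j where "j \<ge> i + K" "holds \<sigma> j \<psi>" "holds \<sigma> i \<phi>"
      "\<And>k. i + K \<le> k \<Longrightarrow> k < j \<Longrightarrow> holds \<sigma> k \<phi>"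
      by (auto simp: holds_Until)
    moreover have "holds \<sigma> k \<phi>" if "i \<le> k" "k < i + K" for k
      using that assms(2)[of k] \<open>holds \<sigma> i \<phi>\<close> by (cases "k = i") auto
    ultimately show ?thesis
      unfolding holds_Until by (intro exI[of _ j]) (meson add_leD1 not_less)
  qed (auto simp: holds_Until)
qed

section \<open>Blocks\<close>

text \<open>A block starts with the marker \<open>m\<close>; the number \<open>c\<close> is represented by the \<open>c\<close>-th domain
  element above \<open>m\<close>.\<close>

locale blocks =
  fixes m :: "'d::linorder" and e :: "nat \<Rightarrow> 'd"
  assumes mono: "strict_mono e" and range: "range e = {m<..}"
begin

lemma above [simp]: "m < e c" "m \<noteq> e c" "e c \<noteq> m" "\<not> e c < m"
  using range by (auto dest: less_imp_neq less_not_sym)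

lemma less_iff [simp]: "e a < e b \<longleftrightarrow> a < b" and eq_iff [simp]: "e a = e b \<longleftrightarrow> a = b"
  using mono by (simp_all add: strict_mono_less strict_mono_eq)

lemma aboveE:
  assumes "m < x"
  obtains c where "x = e c"
  using assms range by (metis greaterThan_iff imageE)

text \<open>The only candidate that has to be tried is \<open>e (Suc a)\<close>, as \<open>e\<close>
  enumerates everything above the marker in increasing order.\<close>

lemma no_value_between: "(\<forall>x. \<not> (e a < x \<and> x < e b)) \<longleftrightarrow> b \<le> Suc a"
proof
  show "b \<le> Suc a" if gap: "\<forall>x. \<not> (e a < x \<and> x < e b)"
    using gap[rule_format, of "e (Suc a)"] by simp
  show "\<forall>x. \<not> (e a < x \<and> x < e b)" if "b \<le> Suc a"
  proof (intro allI notI)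
    fix x
    assume x: "e a < x \<and> x < e b"
    then obtain c where "x = e c"
      using aboveE less_trans[OF above(1)] by blast
    then show False
      using x that by auto
  qed
qed

definition blk :: "(nat \<Rightarrow> 'd \<times> 'd) \<Rightarrow> nat \<Rightarrow> nat \<Rightarrow> (nat \<Rightarrow> nat) \<Rightarrow> bool" where
  "blk \<sigma> i L w \<longleftrightarrow> snd (\<sigma> i) = m \<and> (\<forall>j. 0 < j \<and> j < L \<longrightarrow> snd (\<sigma> (i + j)) = e (w j))"

lemma blk_vals:
  assumes "blk \<sigma> i L w"
  shows "val \<sigma> i (Y 0) = m"
    and "0 < a \<Longrightarrow> a < L \<Longrightarrow> val \<sigma> i (Y a) = e (w a)"
  using assms by (auto simp: blk_def val_Y)

lemma blk_next_vals:
  assumes "blk \<sigma> (i + L) L' w'"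
  shows "val \<sigma> i (YN L 0) = m"
    and "0 < b \<Longrightarrow> b < L' \<Longrightarrow> val \<sigma> i (YN L b) = e (w' b)"
  using assms by (auto simp: blk_def val_YN)

lemma blk_exists:
  assumes "snd (\<sigma> i) = m" "\<And>j. 0 < j \<Longrightarrow> j < L \<Longrightarrow> m < snd (\<sigma> (i + j))"
  shows "\<exists>w. blk \<sigma> i L w"
proof -
  have "\<forall>j. \<exists>c. 0 < j \<and> j < L \<longrightarrow> snd (\<sigma> (i + j)) = e c"
    using assms(2) by (metis aboveE)
  then show ?thesis
    using assms(1) unfolding blk_def by metis
qed

lemma holds_start: "blk \<sigma> i L w \<Longrightarrow> holds \<sigma> i (start L)"
  by (auto simp: start_def blk_vals)

lemma holds_step:
  assumes "blk \<sigma> i L w"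
  shows "holds \<sigma> i (step L L' c \<psi>) \<longleftrightarrow>
    (\<exists>w'. blk \<sigma> (i + L) L' w') \<and> holds \<sigma> i c \<and> holds \<sigma> (i + L) \<psi>"
proof -
  have "(\<exists>w'. blk \<sigma> (i + L) L' w') \<longleftrightarrow>
      val \<sigma> i (YN L 0) = m \<and> (\<forall>j\<in>{1..<L'}. m < val \<sigma> i (YN L j))"
  proof
    show "val \<sigma> i (YN L 0) = m \<and> (\<forall>j\<in>{1..<L'}. m < val \<sigma> i (YN L j))"
      if "\<exists>w'. blk \<sigma> (i + L) L' w'"
      using that blk_next_vals[of \<sigma> i L L'] by force
    show "\<exists>w'. blk \<sigma> (i + L) L' w'"
      if "val \<sigma> i (YN L 0) = m \<and> (\<forall>j\<in>{1..<L'}. m < val \<sigma> i (YN L j))"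
      using that blk_exists[of \<sigma> "i + L" L'] by (simp add: val_YN)
  qed
  then show ?thesis
    unfolding step_def using blk_vals(1)[OF assms] by auto
qed

text \<open>The interface between formulas and numbers: whatever was played before, the contents
  \<open>w\<close> of the block just finished settle whether the system wins. Quantifying over
  \<open>h\<close> and \<open>i\<close> makes this usable at every depth of nesting.\<close>

definition decides :: "nat \<Rightarrow> formula \<Rightarrow> (nat \<Rightarrow> nat) \<Rightarrow> bool \<Rightarrow> bool" where
  "decides L \<phi> w P \<longleftrightarrow>
    (\<forall>h i. length h = i + L \<longrightarrow> blk ((!) h) i L w \<longrightarrow> (win (\<lambda>\<sigma>. holds \<sigma> i \<phi>) h \<longleftrightarrow> P))"

lemma blk_extends:
  assumes "map \<sigma> [0..<length h] = h" "i + L \<le> length h" "L > 0"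
  shows "blk \<sigma> i L w \<longleftrightarrow> blk ((!) h) i L w"
proof -
  have "\<sigma> j = h ! j" if "j < length h" for j
    using assms(1) that by (metis add_0 diff_zero nth_map_upt)
  then show ?thesis
    using assms(2,3) by (simp add: blk_def)
qed

lemma decides_local:
  assumes "L > 0" "\<And>\<sigma> i. blk \<sigma> i L w \<Longrightarrow> holds \<sigma> i \<phi> \<longleftrightarrow> P"
  shows "decides L \<phi> w P"
  unfolding decides_def
proof (intro allI impI)
  fix h :: "('d \<times> 'd) list" and i
  assume h: "length h = i + L" "blk ((!) h) i L w"
  have "win (\<lambda>\<sigma>. holds \<sigma> i \<phi>) h \<longleftrightarrow> win (\<lambda>_. P) h"
    by (rule win_cong) (use h assms blk_extends[of _ h i L w] in auto)
  then show "win (\<lambda>\<sigma>. holds \<sigma> i \<phi>) h \<longleftrightarrow> P"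
    by (simp add: win_const)
qed

lemma decides_TT: "L > 0 \<Longrightarrow> decides L TT w True"
  and decides_FF: "L > 0 \<Longrightarrow> decides L FF w False"
  by (rule decides_local; simp)+

lemma decides_refuted:
  assumes "L > 0" "\<And>\<sigma> i. blk \<sigma> i L w \<Longrightarrow> fst (\<sigma> (i + L)) = x \<Longrightarrow> \<not> holds \<sigma> i \<phi>"
  shows "decides L \<phi> w False"
  unfolding decides_def
proof (intro allI impI)
  fix h :: "('d \<times> 'd) list" and i
  assume h: "length h = i + L" "blk ((!) h) i L w"
  have "\<not> win (\<lambda>\<sigma>. holds \<sigma> i \<phi>) (h @ [(x, y)])" for y
  proof -
    have "win (\<lambda>\<sigma>. holds \<sigma> i \<phi>) (h @ [(x, y)]) \<longleftrightarrow> win (\<lambda>_. False) (h @ [(x, y)])"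
      by (rule win_cong) (use h assms blk_extends[of _ h i L w] in auto)
    then show ?thesis by (simp add: win_const)
  qed
  then show "win (\<lambda>\<sigma>. holds \<sigma> i \<phi>) h \<longleftrightarrow> False"
    by (subst win_round) blast
qed

text \<open>The form of every reduction. The environment's \<open>x\<close> and the numbers
  \<open>w'\<close> of the next block turn the claim into \<open>\<Psi> x w'\<close>, which is
  decided already; a next block that represents no numbers loses at once.\<close>

lemma decides_next_block:
  assumes L: "L > 0" "L' > 0"
    and next_block: "\<And>\<sigma> i. blk \<sigma> i L w \<Longrightarrow> holds \<sigma> i \<phi> \<Longrightarrow> \<exists>w'. blk \<sigma> (i + L) L' w'"
    and unfold: "\<And>\<sigma> i w'. blk \<sigma> i L w \<Longrightarrow> blk \<sigma> (i + L) L' w' \<Longrightarrow>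
      holds \<sigma> i \<phi> \<longleftrightarrow> holds \<sigma> (i + L) (\<Psi> (fst (\<sigma> (i + L))) w')"
    and dec: "\<And>x w'. decides L' (\<Psi> x w') w' (Q x w')"
  shows "decides L \<phi> w (\<forall>x. \<exists>w'. Q x w')"
  unfolding decides_def
proof (intro allI impI)
  fix h :: "('d \<times> 'd) list" and i
  assume h: "length h = i + L" "blk ((!) h) i L w"
  define fits where
    "fits ys w' \<longleftrightarrow> ys ! 0 = m \<and> (\<forall>j. 0 < j \<and> j < L' \<longrightarrow> ys ! j = e (w' j))" for ys w'
  have "win (\<lambda>\<sigma>. holds \<sigma> i \<phi>) h \<longleftrightarrow>
      (\<forall>x. \<exists>ys. length ys = L' \<and> (\<exists>w'. fits ys w' \<and> Q x w'))"
  proof (rule win_rounds[OF L(2)])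
    fix xs ys :: "'d list"
    assume len: "length xs = L'" "length ys = L'"
    define h' where "h' = h @ zip xs ys"
    have h': "length h' = i + L + L'"
      using h len by (simp add: h'_def)
    have nth: "h' ! (i + L + j) = (xs ! j, ys ! j)" if "j < L'" for j
      using that len h(1) by (simp add: h'_def nth_append)
    have old: "blk \<sigma> i L w" if "map \<sigma> [0..<length h'] = h'" for \<sigma>
    proof -
      have "blk ((!) h') i L w \<longleftrightarrow> blk ((!) h) i L w"
        using h(1) L by (auto simp: blk_def h'_def nth_append)
      then show ?thesis
        using h(2) blk_extends[OF that, of i L w] L h' by simp
    qed
    have blk_fits: "blk ((!) h') (i + L) L' w' \<longleftrightarrow> fits ys w'" for w'
      unfolding blk_def fits_def using nth nth[of 0] L by auto
    have new: "blk \<sigma> (i + L) L' w' \<longleftrightarrow> fits ys w'" if "map \<sigma> [0..<length h'] = h'" for \<sigma> w'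
      using blk_extends[OF that, of "i + L" L' w'] blk_fits h' L by simp
    have fst: "fst (\<sigma> (i + L)) = hd xs" if "map \<sigma> [0..<length h'] = h'" for \<sigma>
    proof -
      have "\<sigma> (i + L) = h' ! (i + L)"
        using that h' L by (metis add_0 diff_zero less_add_same_cancel1 nth_map_upt)
      then show ?thesis
        using nth[of 0] L len hd_conv_nth[of xs] by fastforce
    qed
    have fits: "win (\<lambda>\<sigma>. holds \<sigma> i \<phi>) h' \<longleftrightarrow> Q (hd xs) w'" if "fits ys w'" for w'
    proof -
      have "win (\<lambda>\<sigma>. holds \<sigma> i \<phi>) h' \<longleftrightarrow> win (\<lambda>\<sigma>. holds \<sigma> (i + L) (\<Psi> (hd xs) w')) h'"
        by (rule win_cong) (use unfold old new fst that in metis)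
      also have "\<dots> \<longleftrightarrow> Q (hd xs) w'"
        using dec[of "hd xs" w'] h' blk_fits that unfolding decides_def by blast
      finally show ?thesis .
    qed
    show "win (\<lambda>\<sigma>. holds \<sigma> i \<phi>) (h @ zip xs ys) \<longleftrightarrow> (\<exists>w'. fits ys w' \<and> Q (hd xs) w')"
    proof (cases "\<exists>w'. fits ys w'")
      case True
      then show ?thesis using fits unfolding h'_def by blast
    next
      case False
      have "win (\<lambda>\<sigma>. holds \<sigma> i \<phi>) h' \<longleftrightarrow> win (\<lambda>_. False) h'"
        by (rule win_cong) (use next_block old new False in blast)
      then show ?thesis
        using False by (simp add: win_const h'_def)
    qed
  qed
  \<comment> \<open>Every \<open>w'\<close> is written by some sequence of values, so choosing
    values amounts to choosing numbers.\<close>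
  also have "\<dots> \<longleftrightarrow> (\<forall>x. \<exists>w'. Q x w')"
  proof -
    have "\<exists>ys. length ys = L' \<and> fits ys w'" for w'
      using L by (intro exI[of _ "map (\<lambda>j. if j = 0 then m else e (w' j)) [0..<L']"])
        (auto simp: fits_def)
    then show ?thesis by blast
  qed
  finally show "win (\<lambda>\<sigma>. holds \<sigma> i \<phi>) h \<longleftrightarrow> (\<forall>x. \<exists>w'. Q x w')" .
qed

text \<open>A next block that violates the side condition of its branch amounts to claiming
  \<open>FF\<close>, so the subclaims need to be decided only for blocks that meet it.\<close>

lemma decides_Ite_step:
  assumes "L > 0" "L' > 0"
    and b: "\<And>\<sigma> i. blk \<sigma> i L w \<Longrightarrow> holds \<sigma> i b \<longleftrightarrow> B (fst (\<sigma> (i + L)))"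
    and c1: "\<And>\<sigma> i w'. blk \<sigma> i L w \<Longrightarrow> blk \<sigma> (i + L) L' w' \<Longrightarrow>
      holds \<sigma> i c \<longleftrightarrow> R (fst (\<sigma> (i + L))) w'"
    and c2: "\<And>\<sigma> i w'. blk \<sigma> i L w \<Longrightarrow> blk \<sigma> (i + L) L' w' \<Longrightarrow>
      holds \<sigma> i c' \<longleftrightarrow> R' (fst (\<sigma> (i + L))) w'"
    and d1: "\<And>x w'. R x w' \<Longrightarrow> decides L' \<psi> w' (P w')"
    and d2: "\<And>x w'. R' x w' \<Longrightarrow> decides L' \<psi>' w' (P' w')"
  shows "decides L (Ite b (step L L' c \<psi>) (step L L' c' \<psi>')) w
    (\<forall>x. \<exists>w'. if B x then R x w' \<and> P w' else R' x w' \<and> P' w')"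
proof (rule decides_next_block[where L' = L' and \<Psi> = "\<lambda>x w'. if B x then if R x w' then \<psi> else FF
        else if R' x w' then \<psi>' else FF"])
  fix x w'
  show "decides L' (if B x then if R x w' then \<psi> else FF else if R' x w' then \<psi>' else FF) w'
      (if B x then R x w' \<and> P w' else R' x w' \<and> P' w')"
    using d1 d2 decides_FF[OF assms(2)] by auto
qed (use assms in \<open>auto simp: holds_step split: if_splits\<close>)

lemma decides_step:
  assumes "L > 0" "L' > 0"
    and "\<And>\<sigma> i w'. blk \<sigma> i L w \<Longrightarrow> blk \<sigma> (i + L) L' w' \<Longrightarrow>
      holds \<sigma> i c \<longleftrightarrow> R (fst (\<sigma> (i + L))) w'"
    and "\<And>x w'. R x w' \<Longrightarrow> decides L' \<psi> w' (P w')"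
  shows "decides L (step L L' c \<psi>) w (\<forall>x. \<exists>w'. R x w' \<and> P w')"
proof (rule decides_next_block[where L' = L' and \<Psi> = "\<lambda>x w'. if R x w' then \<psi> else FF"])
  fix x w'
  show "decides L' (if R x w' then \<psi> else FF) w' (R x w' \<and> P w')"
    using assms(4) decides_FF[OF assms(2)] by auto
qed (use assms in \<open>auto simp: holds_step\<close>)

definition copied :: "(nat \<times> nat) list \<Rightarrow> (nat \<Rightarrow> nat) \<Rightarrow> (nat \<Rightarrow> nat) \<Rightarrow> bool" where
  "copied ab w w' \<longleftrightarrow> (\<forall>(a, b)\<in>set ab. w' b = w a)"

lemma holds_copies_blk:
  assumes "blk \<sigma> i L w" "blk \<sigma> (i + L) L' w'"
    and "\<forall>(a, b)\<in>set ab. 0 < a \<and> a < L \<and> 0 < b \<and> b < L'"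
  shows "holds \<sigma> i (copies L ab) \<longleftrightarrow> copied ab w w'"
proof -
  have "val \<sigma> i (Y a) = val \<sigma> i (YN L b) \<longleftrightarrow> w' b = w a" if "(a, b) \<in> set ab" for a b
    using assms(3) that blk_vals(2)[OF assms(1), of a] blk_next_vals(2)[OF assms(2), of b] by auto
  then show ?thesis
    unfolding holds_copies copied_def by blast
qed

end

section \<open>Claims about recursive functions as games\<close>

definition args :: "(nat \<Rightarrow> nat) \<Rightarrow> nat \<Rightarrow> nat \<Rightarrow> nat list" where
  "args w a n = map (\<lambda>q. w (a + q)) [0..<n]"

lemma length_args [simp]: "length (args w a n) = n"
  by (simp add: args_def)

lemma args_0 [simp]: "args w a 0 = []"
  by (simp add: args_def)

lemma args_Suc: "args w a (Suc n) = args w a n @ [w (a + n)]"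
  by (simp add: args_def)

lemma args_Cons: "args w a (Suc n) = w a # args w (Suc a) n"
  by (simp add: args_def upt_conv_Cons map_Suc_upt [symmetric] del: upt_Suc)

lemma nth_args: "q < n \<Longrightarrow> args w a n ! q = w (a + q)"
  by (simp add: args_def)

lemma args_eqI: "(\<And>q. q < n \<Longrightarrow> w' (b + q) = w (a + q)) \<Longrightarrow> args w' b n = args w a n"
  by (simp add: args_def)

text \<open>The subclaims of a composition with arguments \<open>xs\<close>: the first \<open>j\<close> intermediate results are
  in the slots after \<open>xs\<close>. The next one is guessed, and the environment either has it checked
  or proceeds.\<close>

primrec chain :: "nat \<Rightarrow> nat \<Rightarrow> formula \<Rightarrow> formula list \<Rightarrow> nat \<Rightarrow> formula" where
  "chain K n F [] j =
    step K K (copies K ((1, 1) # (2, 2) # map (\<lambda>q. (3 + n + q, 3 + q)) [0..<j])) F"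
| "chain K n F (G # Gs) j =
    step K K (copies K (map (\<lambda>a. (a, a)) [1..<3 + n + j]))
      (Ite (lt (Y 0) (X K))
        (step K K (copies K ((1, 1) # (3 + n + j, 2) # map (\<lambda>q. (3 + q, 3 + q)) [0..<n])) G)
        (step K K (copies K (map (\<lambda>a. (a, a)) [1..<4 + n + j])) (chain K n F Gs (Suc j))))"

text \<open>Demands only a smaller counter, which makes the loop terminate. That it is the
  predecessor is enforced by \<open>prec_check\<close>, the option the environment takes to expose a
  gap.\<close>

definition prec_descend :: "nat \<Rightarrow> nat \<Rightarrow> formula \<Rightarrow> formula" where
  "prec_descend K p =
    step K K (Conj (lt (Y (4 + p)) (Y 3))
      (copies K ((1, 1) # (5 + p, 2) # (4 + p, 3) # map (\<lambda>q. (4 + q, 4 + q)) [0..<p])))"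

text \<open>\<open>g\<close> receives the predecessor and the intermediate result before the
  parameters, hence the shift from \<open>4 + q\<close> to \<open>5 + q\<close>.\<close>

definition prec_check :: "nat \<Rightarrow> nat \<Rightarrow> formula \<Rightarrow> formula" where
  "prec_check K p =
    step K K (Conj (Conj (lt (Y (4 + p)) (Y 3)) (no_gap K (4 + p) 3))
      (copies K ((1, 1) # (2, 2) # (4 + p, 3) # (5 + p, 4) # map (\<lambda>q. (4 + q, 5 + q)) [0..<p])))"

definition prec_base :: "nat \<Rightarrow> nat \<Rightarrow> formula \<Rightarrow> formula" where
  "prec_base K p =
    step K K (copies K ((1, 1) # (2, 2) # map (\<lambda>q. (4 + q, 3 + q)) [0..<p]))"

text \<open>A block of the loop holds the result, the counter, the parameters, the predecessor of the
  counter and the intermediate result there. The environment either has the recursion step checked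
  or descends to the predecessor.\<close>

definition prec_loop :: "nat \<Rightarrow> nat \<Rightarrow> formula \<Rightarrow> formula \<Rightarrow> formula" where
  "prec_loop K p F G =
    Until
      (Or (Neg (start K))
        (Conj (Neg (eq (Y 3) (Y 1))) (Conj (Neg (lt (Y 0) (X K))) (prec_descend K p TT))))
      (Conj (start K)
        (Ite (eq (Y 3) (Y 1)) (prec_base K p F) (Conj (lt (Y 0) (X K)) (prec_check K p G))))"

text \<open>In a block of \<open>K\<close> rounds, slot \<open>1\<close> holds \<open>0\<close>, slot \<open>2\<close> holds the claimed result, and the
  arguments start at slot \<open>3\<close>.\<close>

fun claim :: "nat \<Rightarrow> nat \<Rightarrow> recf \<Rightarrow> formula" where
  "claim K n Zero = eq (Y 2) (Y 1)"
| "claim K n Succ =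
    (if n = 1 then step K K (Conj (lt (Y 3) (Y 2)) (no_gap K 3 2)) TT else FF)"
| "claim K n (Proj q) = (if q < n then eq (Y 2) (Y (3 + q)) else FF)"
| "claim K n (Comp f gs) = chain K n (claim K (length gs) f) (map (claim K n) gs) 0"
| "claim K n (Prec f g) =
    (case n of
      0 \<Rightarrow> FF
    | Suc p \<Rightarrow> step K K (copies K (map (\<lambda>a. (a, a)) [1..<4 + p]))
        (prec_loop K p (claim K p f) (claim K (Suc (Suc p)) g)))"
| "claim K n (Mu f) =
    Ite (Conj (lt (Y 0) (X K)) (lt (X K) (Y 2)))
      (step K K (Conj (Conj (lt (YN K 1) (YN K 2)) (eq (X K) (YN K 3)))
        (copies K ((1, 1) # map (\<lambda>q. (3 + q, 4 + q)) [0..<n]))) (claim K (Suc n) f))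
      (step K K (copies K ((1, 1) # (1, 2) # (2, 3) # map (\<lambda>q. (3 + q, 4 + q)) [0..<n]))
        (claim K (Suc n) f))"

text \<open>A generous bound on the block length: the needs of the subterms are added, so that one
  \<open>K\<close> serves a claim and all its subclaims.\<close>

fun slots :: "nat \<Rightarrow> recf \<Rightarrow> nat" where
  "slots n Zero = 3"
| "slots n Succ = 4"
| "slots n (Proj q) = 3 + n"
| "slots n (Comp f gs) =
    4 + n + length gs + slots (length gs) f + sum_list (map (slots n) gs)"
| "slots n (Prec f g) = 6 + n + slots (n - 1) f + slots (Suc n) g"
| "slots n (Mu f) = 5 + n + slots (Suc n) f"

text \<open>\<open>rec_eval\<close> asks for definedness below some zero; since the least zero is
  below it, only the arguments up to the value matter, and these are the ones the game
  checks.\<close>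

lemma rec_eval_Mu_iff:
  "rec_eval (Mu f) xs = Some v \<longleftrightarrow>
    (\<forall>a<v. \<exists>u>0. rec_eval f (a # xs) = Some u) \<and> rec_eval f (v # xs) = Some 0"
  (is "_ \<longleftrightarrow> ?rhs")
proof
  let ?zero = "\<lambda>n. rec_eval f (n # xs) = Some 0"
  assume "rec_eval (Mu f) xs = Some v"
  then obtain n where n: "?zero n" "\<forall>a<n. rec_eval f (a # xs) \<noteq> None"
    and v: "v = (LEAST n. ?zero n)"
    by (auto split: if_splits)
  have "?zero v" "v \<le> n"
    unfolding v using n(1) by (rule LeastI, rule Least_le)
  moreover have "\<not> ?zero a" if "a < v" for a
    using that not_less_Least unfolding v by blast
  ultimately show ?rhs
    using n(2) by (metis gr0I less_le_trans not_None_eq)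
next
  assume v: ?rhs
  then have "(LEAST n. rec_eval f (n # xs) = Some 0) = v"
    by (intro Least_equality) (force simp: not_less[symmetric])+
  moreover have "\<forall>a<v. rec_eval f (a # xs) \<noteq> None"
    using v by fastforce
  ultimately show "rec_eval (Mu f) xs = Some v"
    using v by auto
qed

text \<open>One unrolling of the recursion with the guesses explicit. At \<open>N = 0\<close> they
  are free: the loop block has slots for them in any case.\<close>

definition prec_ok :: "recf \<Rightarrow> recf \<Rightarrow> nat \<Rightarrow> nat \<Rightarrow> nat list \<Rightarrow> nat \<Rightarrow> nat \<Rightarrow> bool" where
  "prec_ok f g v N ys M u \<longleftrightarrow>
    (if N = 0 then rec_eval f ys = Some v
     else N = Suc M \<and> rec_eval g (M # u # ys) = Some v \<and> rec_eval (Prec f g) (M # ys) = Some u)"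

lemma ex_prec_ok:
  "(\<exists>M u. prec_ok f g v N ys M u) \<longleftrightarrow> rec_eval (Prec f g) (N # ys) = Some v"
  by (cases N) (auto simp: prec_ok_def split: option.splits)

definition prec_state :: "recf \<Rightarrow> recf \<Rightarrow> nat \<Rightarrow> (nat \<Rightarrow> nat) \<Rightarrow> bool" where
  "prec_state f g p w \<longleftrightarrow> prec_ok f g (w 2) (w 3) (args w 4 p) (w (4 + p)) (w (5 + p))"

section \<open>Correctness of the claims\<close>

context blocks
begin

text \<open>Both \<open>m\<close> and values above \<open>m\<close> are available as moves, so a
  test against the marker is a free choice of the environment between two checks.\<close>

lemma all_choices: "(\<forall>x. if m < x then A else B) \<longleftrightarrow> A \<and> B"
  by (metis above(1) less_irrefl)

lemma ex_if: "(\<exists>w. if b then P w else Q w) \<longleftrightarrow> (if b then \<exists>w. P w else \<exists>w. Q w)"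
  by simp

text \<open>Applied to a copying condition \<open>R\<close>, which fixes all slots that
  \<open>P\<close> reads, so that the choice of the next block disappears.\<close>

lemma ex_conj_eq:
  assumes "R w\<^sub>0" "\<And>w. R w \<Longrightarrow> P w \<longleftrightarrow> Q"
  shows "(\<exists>w. R w \<and> P w) \<longleftrightarrow> Q"
  using assms by blast

text \<open>The results guessed so far follow the arguments in the block, and \<open>zs\<close> are
  the missing ones. Each guess has a block of its own, because the environment must see it before
  deciding whether to challenge it.\<close>

lemma decides_chain:
  assumes "4 + n + j + length gs \<le> K" and "w 1 = 0"
    and "\<And>w. w 1 = 0 \<Longrightarrow>
      decides K F w (rec_eval f (args w 3 (j + length gs)) = Some (w 2))"
    and "\<And>g w. g \<in> set gs \<Longrightarrow> w 1 = 0 \<Longrightarrow>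
      decides K (\<Gamma> g) w (rec_eval g (args w 3 n) = Some (w 2))"
  shows "decides K (chain K n F (map \<Gamma> gs) j) w
    (\<exists>zs. those (map (\<lambda>g. rec_eval g (args w 3 n)) gs) = Some zs \<and>
      rec_eval f (args w (3 + n) j @ zs) = Some (w 2))"
  using assms
proof (induction gs arbitrary: j w)
  case Nil
  let ?ab = "(1, 1) # (2, 2) # map (\<lambda>q. (3 + n + q, 3 + q)) [0..<j]"
  have "decides K (step K K (copies K ?ab) F) w
      (\<forall>x::'d. \<exists>w'. copied ?ab w w' \<and> rec_eval f (args w' 3 j) = Some (w' 2))"
  proof (rule decides_step[where R = "\<lambda>_. copied ?ab w" and
        P = "\<lambda>w'. rec_eval f (args w' 3 j) = Some (w' 2)"])
    show "K > 0" "K > 0" using Nil.prems by auto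
    show "holds \<sigma> i (copies K ?ab) \<longleftrightarrow> copied ?ab w w'"
      if "blk \<sigma> i K w" "blk \<sigma> (i + K) K w'" for \<sigma> i w'
      by (rule holds_copies_blk[OF that]) (use Nil.prems in auto)
    show "decides K F w' (rec_eval f (args w' 3 j) = Some (w' 2))" if "copied ?ab w w'" for w'
      using Nil.prems(3)[of w'] Nil.prems(2) that by (simp add: copied_def)
  qed
  moreover have "(\<exists>w'. copied ?ab w w' \<and> rec_eval f (args w' 3 j) = Some (w' 2)) \<longleftrightarrow>
      rec_eval f (args w (3 + n) j) = Some (w 2)"
  proof (rule ex_conj_eq)
    \<comment> \<open>The slots from \<open>3\<close> on move down by \<open>n\<close>: the
      intermediate results replace the arguments.\<close>
    show "copied ?ab w (\<lambda>b. if b < 3 then w b else w (b + n))"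
      by (auto simp: copied_def add_ac)
    fix w'
    assume "copied ?ab w w'"
    then have "args w' 3 j = args w (3 + n) j" "w' 2 = w 2"
      by (auto simp: copied_def intro!: args_eqI)
    then show "rec_eval f (args w' 3 j) = Some (w' 2) \<longleftrightarrow>
        rec_eval f (args w (3 + n) j) = Some (w 2)"
      by (simp only:)
  qed
  ultimately show ?case by simp
next
  case (Cons g gs)
  let ?ab = "map (\<lambda>a. (a, a)) [1..<3 + n + j]"
  let ?ab1 = "(1, 1) # (3 + n + j, 2) # map (\<lambda>q. (3 + q, 3 + q)) [0..<n]"
  let ?ab2 = "map (\<lambda>a. (a, a)) [1..<4 + n + j]"
  let ?Q = "\<lambda>w j. \<exists>zs. those (map (\<lambda>g. rec_eval g (args w 3 n)) gs) = Some zs \<and>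
      rec_eval f (args w (3 + n) j @ zs) = Some (w 2)"
  let ?I = "Ite (lt (Y 0) (X K)) (step K K (copies K ?ab1) (\<Gamma> g))
      (step K K (copies K ?ab2) (chain K n F (map \<Gamma> gs) (Suc j)))"
  have K: "K > 0" using Cons.prems by auto
  have inner: "decides K ?I w (rec_eval g (args w 3 n) = Some (w (3 + n + j)) \<and> ?Q w (Suc j))"
    if w: "w 1 = 0" for w
  proof -
    have "decides K ?I w (\<forall>x. \<exists>w'. if m < x
        then copied ?ab1 w w' \<and> rec_eval g (args w' 3 n) = Some (w' 2)
        else copied ?ab2 w w' \<and> ?Q w' (Suc j))"
    proof (rule decides_Ite_step[where R = "\<lambda>_. copied ?ab1 w" and R' = "\<lambda>_. copied ?ab2 w"
          and B = "\<lambda>x. m < x" and P = "\<lambda>w'. rec_eval g (args w' 3 n) = Some (w' 2)"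
          and P' = "\<lambda>w'. ?Q w' (Suc j)"])
      show "holds \<sigma> i (lt (Y 0) (X K)) \<longleftrightarrow> m < fst (\<sigma> (i + K))" if "blk \<sigma> i K w" for \<sigma> i
        using that by (simp add: blk_vals val_X)
      show "holds \<sigma> i (copies K ?ab1) \<longleftrightarrow> copied ?ab1 w w'"
        "holds \<sigma> i (copies K ?ab2) \<longleftrightarrow> copied ?ab2 w w'"
        if "blk \<sigma> i K w" "blk \<sigma> (i + K) K w'" for \<sigma> i w'
        by (rule holds_copies_blk[OF that]; use Cons.prems in auto)+
      show "decides K (\<Gamma> g) w' (rec_eval g (args w' 3 n) = Some (w' 2))" if "copied ?ab1 w w'" for w'
        using Cons.prems(4)[of g w'] w that by (simp add: copied_def)
      show "decides K (chain K n F (map \<Gamma> gs) (Suc j)) w' (?Q w' (Suc j))" if "copied ?ab2 w w'" for w'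
        by (rule Cons.IH) (use Cons.prems w that in \<open>auto simp: copied_def\<close>)
    qed (use K in auto)
    moreover have "(\<exists>w'. copied ?ab1 w w' \<and> rec_eval g (args w' 3 n) = Some (w' 2)) \<longleftrightarrow>
        rec_eval g (args w 3 n) = Some (w (3 + n + j))"
    proof (rule ex_conj_eq)
      show "copied ?ab1 w (w(2 := w (3 + n + j)))"
        by (auto simp: copied_def)
      fix w'
      assume "copied ?ab1 w w'"
      then have "args w' 3 n = args w 3 n" "w' 2 = w (3 + n + j)"
        by (auto simp: copied_def intro!: args_eqI)
      then show "rec_eval g (args w' 3 n) = Some (w' 2) \<longleftrightarrow>
          rec_eval g (args w 3 n) = Some (w (3 + n + j))"
        by (simp only:)
    qed
    moreover have "(\<exists>w'. copied ?ab2 w w' \<and> ?Q w' (Suc j)) \<longleftrightarrow> ?Q w (Suc j)"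
    proof (rule ex_conj_eq)
      show "copied ?ab2 w w"
        by (auto simp: copied_def)
      fix w'
      assume "copied ?ab2 w w'"
      then have "args w' 3 n = args w 3 n" "args w' (3 + n) (Suc j) = args w (3 + n) (Suc j)"
          "w' 2 = w 2"
        by (auto simp: copied_def intro!: args_eqI)
      then show "?Q w' (Suc j) \<longleftrightarrow> ?Q w (Suc j)"
        by (simp only:)
    qed
    ultimately show ?thesis
      by (simp only: ex_if all_choices)
  qed
  have "decides K (step K K (copies K ?ab) ?I) w (\<forall>x::'d. \<exists>w'. copied ?ab w w' \<and>
      (rec_eval g (args w' 3 n) = Some (w' (3 + n + j)) \<and> ?Q w' (Suc j)))"
  proof (rule decides_step[where R = "\<lambda>_. copied ?ab w" and
        P = "\<lambda>w'. rec_eval g (args w' 3 n) = Some (w' (3 + n + j)) \<and> ?Q w' (Suc j)"])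
    show "holds \<sigma> i (copies K ?ab) \<longleftrightarrow> copied ?ab w w'"
      if "blk \<sigma> i K w" "blk \<sigma> (i + K) K w'" for \<sigma> i w'
      by (rule holds_copies_blk[OF that]; use Cons.prems in auto)
    show "decides K ?I w' (rec_eval g (args w' 3 n) = Some (w' (3 + n + j)) \<and> ?Q w' (Suc j))"
      if "copied ?ab w w'" for w'
      by (rule inner) (use that Cons.prems in \<open>simp add: copied_def\<close>)
  qed (use K in auto)
  moreover have "(\<exists>w'. copied ?ab w w' \<and>
      (rec_eval g (args w' 3 n) = Some (w' (3 + n + j)) \<and> ?Q w' (Suc j))) \<longleftrightarrow>
      (\<exists>y. rec_eval g (args w 3 n) = Some y \<and>
        (\<exists>zs. those (map (\<lambda>g. rec_eval g (args w 3 n)) gs) = Some zs \<and>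
          rec_eval f (args w (3 + n) j @ y # zs) = Some (w 2)))" (is "?lhs \<longleftrightarrow> ?rhs")
  proof
    have "args w' 3 n = args w 3 n \<and> args w' (3 + n) j = args w (3 + n) j \<and> w' 2 = w 2"
      if "copied ?ab w w'" for w'
      using that by (auto simp: copied_def intro!: args_eqI)
    then show "?lhs \<Longrightarrow> ?rhs"
      by (fastforce simp: args_Suc)
    show "?lhs" if rhs: ?rhs
    proof -
      obtain y where y: "rec_eval g (args w 3 n) = Some y"
        "\<exists>zs. those (map (\<lambda>g. rec_eval g (args w 3 n)) gs) = Some zs \<and>
          rec_eval f (args w (3 + n) j @ y # zs) = Some (w 2)"
        using rhs by blast
      \<comment> \<open>Slot \<open>3 + n + j\<close> is the first one not copied, so the system may
        put the true value of \<open>g\<close> there.\<close>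
      let ?w = "w(3 + n + j := y)"
      have "args ?w 3 n = args w 3 n" "args ?w (3 + n) j = args w (3 + n) j" "?w 2 = w 2"
        by (auto intro!: args_eqI)
      then show ?thesis
        using y by (intro exI[of _ ?w]) (auto simp: args_Suc copied_def)
    qed
  qed
  moreover have "?rhs \<longleftrightarrow>
      (\<exists>zs. those (map (\<lambda>g. rec_eval g (args w 3 n)) (g # gs)) = Some zs \<and>
        rec_eval f (args w (3 + n) j @ zs) = Some (w 2))"
    by (cases "rec_eval g (args w 3 n)") auto
  ultimately show ?case
    by (simp only: list.map chain.simps simp_thms)
qed

text \<open>Induction on the counter in slot \<open>3\<close>, which decreases with every descent,
  so that the Until is left after finitely many blocks.\<close>

lemma decides_prec_loop:
  assumes "p + 6 \<le> K" and "w 1 = 0"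
    and F: "\<And>w. w 1 = 0 \<Longrightarrow> decides K F w (rec_eval f (args w 3 p) = Some (w 2))"
    and G: "\<And>w. w 1 = 0 \<Longrightarrow>
      decides K G w (rec_eval g (args w 3 (Suc (Suc p))) = Some (w 2))"
  shows "decides K (prec_loop K p F G) w (prec_state f g p w)"
  using assms(2)
proof (induction "w 3" arbitrary: w rule: less_induct)
  case less
  let ?U = "prec_loop K p F G"
  let ?M = "4 + p" and ?u = "5 + p"
  let ?ab0 = "(1, 1) # (2, 2) # map (\<lambda>q. (4 + q, 3 + q)) [0..<p]"
  let ?ab1 = "(1, 1) # (2, 2) # (?M, 3) # (?u, 4) # map (\<lambda>q. (4 + q, 5 + q)) [0..<p]"
  let ?ab2 = "(1, 1) # (?u, 2) # (?M, 3) # map (\<lambda>q. (4 + q, 4 + q)) [0..<p]"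
  have K: "K > 0" using assms(1) by simp
  let ?\<phi> = "Or (Neg (start K))
        (Conj (Neg (eq (Y 3) (Y 1))) (Conj (Neg (lt (Y 0) (X K))) (prec_descend K p TT)))"
  let ?\<psi> = "Conj (start K)
        (Ite (eq (Y 3) (Y 1)) (prec_base K p F) (Conj (lt (Y 0) (X K)) (prec_check K p G)))"
  have unfold: "holds \<sigma> i ?U \<longleftrightarrow>
      (if w 3 = 0 then holds \<sigma> i (prec_base K p F)
       else if m < fst (\<sigma> (i + K)) then holds \<sigma> i (prec_check K p G)
       else holds \<sigma> i (prec_descend K p ?U))"
    if blk: "blk \<sigma> i K w" for \<sigma> i
  proof -
    have "holds \<sigma> i ?U \<longleftrightarrow> holds \<sigma> i ?\<psi> \<or> holds \<sigma> i ?\<phi> \<and> holds \<sigma> (i + K) ?U"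
      unfolding prec_loop_def
    proof (rule holds_Until_block[OF K])
      fix k
      assume k: "i < k" "k < i + K" and "holds \<sigma> i ?\<phi>"
      \<comment> \<open>\<open>start K\<close> holds at \<open>i\<close>, so \<open>?\<phi>\<close>
        can hold there only through the descent, which forces a next block. Its marker then refutes
        \<open>start K\<close> at the inner round \<open>k\<close>.\<close>
      then obtain w' where "blk \<sigma> (i + K) K w'"
        using holds_start[OF blk] by (auto simp: prec_descend_def holds_step[OF blk])
      then have "val \<sigma> k (Y (i + K - k)) = m"
        using k by (simp add: val_Y blk_def)
      moreover have "val \<sigma> k (Y 0) = e (w (k - i))"
        using k blk unfolding blk_def val_Y
        by (metis add.right_neutral le_add_diff_inverse less_diff_conv2 less_or_eq_imp_le
            add.commute zero_less_diff)
      moreover have "val \<sigma> k (Y 0) < val \<sigma> k (Y (i + K - k))" if "holds \<sigma> k (start K)"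
      proof -
        have "i + K - k \<in> {1..<K}"
          using k by auto
        then show ?thesis
          using that by (simp add: start_def)
      qed
      ultimately have "\<not> holds \<sigma> k (start K)"
        by auto
      then show "holds \<sigma> k ?\<phi> \<and> \<not> holds \<sigma> k ?\<psi>"
        by simp
    qed
    moreover have "val \<sigma> i (Y 3) = e (w 3)" "val \<sigma> i (Y 1) = e (w 1)" "val \<sigma> i (Y 0) = m"
      using blk_vals[OF blk] assms(1) by simp_all
    ultimately show ?thesis
      using holds_start[OF blk] less.prems
      by (auto simp: prec_descend_def holds_step[OF blk] val_X)
  qed
  let ?gap = "\<lambda>x. e (w ?M) < x \<and> x < e (w 3)"
  have "decides K ?U w (\<forall>x. \<exists>w'.
    if w 3 = 0 then copied ?ab0 w w' \<and> rec_eval f (args w' 3 p) = Some (w' 2)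
    else if m < x then (w ?M < w 3 \<and> \<not> ?gap x \<and> copied ?ab1 w w') \<and>
      rec_eval g (args w' 3 (Suc (Suc p))) = Some (w' 2)
    else (w ?M < w 3 \<and> copied ?ab2 w w') \<and> prec_state f g p w')"
  proof (rule decides_next_block[where L' = K and \<Psi> = "\<lambda>x w'.
        if w 3 = 0 then if copied ?ab0 w w' then F else FF
        else if m < x then if w ?M < w 3 \<and> \<not> ?gap x \<and> copied ?ab1 w w' then G else FF
        else if w ?M < w 3 \<and> copied ?ab2 w w' then ?U else FF"])
    show "K > 0" "K > 0" by (fact K)+
    show "\<exists>w'. blk \<sigma> (i + K) K w'" if "blk \<sigma> i K w" "holds \<sigma> i ?U" for \<sigma> i
      using that unfold[OF that(1)]
      by (auto simp: prec_base_def prec_check_def prec_descend_def holds_step[OF that(1)]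
          split: if_splits)
    show "holds \<sigma> i ?U \<longleftrightarrow> holds \<sigma> (i + K)
        (if w 3 = 0 then if copied ?ab0 w w' then F else FF
        else if m < fst (\<sigma> (i + K))
          then if w ?M < w 3 \<and> \<not> ?gap (fst (\<sigma> (i + K))) \<and> copied ?ab1 w w' then G else FF
        else if w ?M < w 3 \<and> copied ?ab2 w w' then ?U else FF)"
      if blk: "blk \<sigma> i K w" and blk': "blk \<sigma> (i + K) K w'" for \<sigma> i w'
    proof -
      have "holds \<sigma> i (copies K ?ab0) \<longleftrightarrow> copied ?ab0 w w'"
        "holds \<sigma> i (copies K ?ab1) \<longleftrightarrow> copied ?ab1 w w'"
        "holds \<sigma> i (copies K ?ab2) \<longleftrightarrow> copied ?ab2 w w'"
        by (rule holds_copies_blk[OF blk blk']; use assms(1) in auto)+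
      moreover have "val \<sigma> i (Y ?M) = e (w ?M)" "val \<sigma> i (Y 3) = e (w 3)"
        using blk_vals[OF blk] assms(1) by simp_all
      ultimately show ?thesis
        unfolding unfold[OF blk] prec_base_def prec_check_def prec_descend_def holds_step[OF blk]
        using blk' by (auto simp: holds_no_gap)
    qed
    fix x w'
    have "decides K F w' (rec_eval f (args w' 3 p) = Some (w' 2))" if "copied ?ab0 w w'"
      using F[of w'] that less.prems by (simp add: copied_def)
    moreover have "decides K G w' (rec_eval g (args w' 3 (Suc (Suc p))) = Some (w' 2))"
      if "copied ?ab1 w w'"
      using G[of w'] that less.prems by (simp add: copied_def)
    moreover have "decides K ?U w' (prec_state f g p w')" if "w ?M < w 3" "copied ?ab2 w w'"
      using less.hyps[of w'] that less.prems by (simp add: copied_def)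
    ultimately show "decides K
        (if w 3 = 0 then if copied ?ab0 w w' then F else FF
        else if m < x then if w ?M < w 3 \<and> \<not> ?gap x \<and> copied ?ab1 w w' then G else FF
        else if w ?M < w 3 \<and> copied ?ab2 w w' then ?U else FF) w'
        (if w 3 = 0 then copied ?ab0 w w' \<and> rec_eval f (args w' 3 p) = Some (w' 2)
        else if m < x then (w ?M < w 3 \<and> \<not> ?gap x \<and> copied ?ab1 w w') \<and>
          rec_eval g (args w' 3 (Suc (Suc p))) = Some (w' 2)
        else (w ?M < w 3 \<and> copied ?ab2 w w') \<and> prec_state f g p w')"
      using decides_FF[OF K] by auto
  qed
  moreover have "(\<exists>w'. copied ?ab0 w w' \<and> rec_eval f (args w' 3 p) = Some (w' 2)) \<longleftrightarrow>
      rec_eval f (args w 4 p) = Some (w 2)"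
  proof (rule ex_conj_eq)
    show "copied ?ab0 w (\<lambda>b. if b < 3 then w b else w (b + 1))"
      by (auto simp: copied_def)
    fix w'
    assume "copied ?ab0 w w'"
    then have "args w' 3 p = args w 4 p" "w' 2 = w 2"
      by (auto simp: copied_def intro!: args_eqI)
    then show "rec_eval f (args w' 3 p) = Some (w' 2) \<longleftrightarrow> rec_eval f (args w 4 p) = Some (w 2)"
      by (simp only:)
  qed
  moreover have "(\<exists>w'. copied ?ab1 w w' \<and> rec_eval g (args w' 3 (Suc (Suc p))) = Some (w' 2)) \<longleftrightarrow>
      rec_eval g (w ?M # w ?u # args w 4 p) = Some (w 2)"
  proof (rule ex_conj_eq)
    show "copied ?ab1 w (\<lambda>b. if b < 3 then w b else if b = 3 then w ?M else if b = 4 then w ?u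
        else w (b - 1))"
      by (auto simp: copied_def)
    fix w'
    assume "copied ?ab1 w w'"
    then have "args w' 5 p = args w 4 p" "w' 3 = w ?M" "w' 4 = w ?u" "w' 2 = w 2"
      by (auto simp: copied_def intro!: args_eqI)
    then show "rec_eval g (args w' 3 (Suc (Suc p))) = Some (w' 2) \<longleftrightarrow>
        rec_eval g (w ?M # w ?u # args w 4 p) = Some (w 2)"
      by (simp add: args_Cons)
  qed
  moreover have "(\<exists>w'. copied ?ab2 w w' \<and> prec_state f g p w') \<longleftrightarrow>
      rec_eval (Prec f g) (w ?M # args w 4 p) = Some (w ?u)"
    (is "?lhs \<longleftrightarrow> _")
  proof -
    have "?lhs \<longleftrightarrow> (\<exists>M u. prec_ok f g (w ?u) (w ?M) (args w 4 p) M u)"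
    proof
      assume ?lhs
      then obtain w' where w': "copied ?ab2 w w'" "prec_state f g p w'"
        by blast
      have "args w' 4 p = args w 4 p" "w' 2 = w ?u" "w' 3 = w ?M"
        using w'(1) by (auto simp: copied_def intro!: args_eqI)
      then show "\<exists>M u. prec_ok f g (w ?u) (w ?M) (args w 4 p) M u"
        using w'(2) by (auto simp: prec_state_def)
    next
      assume "\<exists>M u. prec_ok f g (w ?u) (w ?M) (args w 4 p) M u"
      then obtain M u where ok: "prec_ok f g (w ?u) (w ?M) (args w 4 p) M u"
        by blast
      \<comment> \<open>The descent does not copy into slots \<open>4 + p\<close> and
        \<open>5 + p\<close>, which take the guesses for the smaller counter.\<close>
      let ?w = "w(2 := w ?u, 3 := w ?M, ?M := M, ?u := u)"
      have "args ?w 4 p = args w 4 p"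
        by (auto intro!: args_eqI)
      then have "prec_state f g p ?w"
        using ok by (simp add: prec_state_def)
      moreover have "copied ?ab2 w ?w"
        by (auto simp: copied_def)
      ultimately show ?lhs by blast
    qed
    then show ?thesis
      by (simp only: ex_prec_ok)
  qed
  \<comment> \<open>Three moves matter: \<open>m\<close> chooses the descent, \<open>e 0\<close> the
    check, and \<open>e (Suc (w ?M))\<close> exposes a counter beyond the successor of the
    guess.\<close>
  moreover have "(\<forall>x. if m < x then (w ?M < w 3 \<and> \<not> ?gap x) \<and> A else w ?M < w 3 \<and> B) \<longleftrightarrow>
      w 3 = Suc (w ?M) \<and> A \<and> B" (is "?all \<longleftrightarrow> ?succ") for A B
  proof
    assume all: ?all
    have "\<not> Suc (w ?M) < w 3"
      using all[rule_format, of "e (Suc (w ?M))"] by (auto split: if_splits)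
    then show ?succ
      using all[rule_format, of m] all[rule_format, of "e 0"] by (auto split: if_splits)
  next
    assume succ: ?succ
    have "\<not> ?gap x" if "m < x" for x
      using succ aboveE[OF that] by (metis less_iff not_less_eq)
    then show ?all
      using succ by auto
  qed
  ultimately show ?case
    unfolding prec_state_def prec_ok_def
    by (cases "w 3 = 0") (simp_all only: if_True if_False ex_if conj_assoc ex_simps simp_thms)
qed

text \<open>A move \<open>e a\<close> with \<open>a\<close> below the claimed result demands a
  positive value at \<open>a\<close>; any other move demands the value \<open>0\<close> at the
  claimed result. These are the conditions of \<open>rec_eval_Mu_iff\<close>.\<close>

lemma decides_mu:
  assumes "n + 5 \<le> K" and w: "w 1 = 0"
    and F: "\<And>w. w 1 = 0 \<Longrightarrow>
      decides K (claim K (Suc n) f) w (rec_eval f (args w 3 (Suc n)) = Some (w 2))"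
  shows "decides K (claim K n (Mu f)) w (rec_eval (Mu f) (args w 3 n) = Some (w 2))"
proof -
  let ?ab = "(1, 1) # map (\<lambda>q. (3 + q, 4 + q)) [0..<n]"
  let ?ab' = "(1, 1) # (1, 2) # (2, 3) # map (\<lambda>q. (3 + q, 4 + q)) [0..<n]"
  let ?P = "\<lambda>w. rec_eval f (args w 3 (Suc n)) = Some (w 2)"
  have "decides K (claim K n (Mu f)) w (\<forall>x. \<exists>w'. if m < x \<and> x < e (w 2)
      then ((w' 1 < w' 2 \<and> x = e (w' 3)) \<and> copied ?ab w w') \<and> ?P w'
      else copied ?ab' w w' \<and> ?P w')"
    unfolding claim.simps
  proof (rule decides_Ite_step[where R = "\<lambda>x w'. (w' 1 < w' 2 \<and> x = e (w' 3)) \<and> copied ?ab w w'"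
        and R' = "\<lambda>_. copied ?ab' w" and B = "\<lambda>x. m < x \<and> x < e (w 2)" and P = ?P and P' = ?P])
    show "K > 0" "K > 0" using assms(1) by simp_all
    show "holds \<sigma> i (Conj (lt (Y 0) (X K)) (lt (X K) (Y 2))) \<longleftrightarrow>
        m < fst (\<sigma> (i + K)) \<and> fst (\<sigma> (i + K)) < e (w 2)" if "blk \<sigma> i K w" for \<sigma> i
      using blk_vals[OF that] assms(1) by (simp add: val_X)
    show "holds \<sigma> i (Conj (Conj (lt (YN K 1) (YN K 2)) (eq (X K) (YN K 3))) (copies K ?ab)) \<longleftrightarrow>
        (w' 1 < w' 2 \<and> fst (\<sigma> (i + K)) = e (w' 3)) \<and> copied ?ab w w'"
      if "blk \<sigma> i K w" "blk \<sigma> (i + K) K w'" for \<sigma> i w'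
    proof -
      have "holds \<sigma> i (copies K ?ab) \<longleftrightarrow> copied ?ab w w'"
        by (rule holds_copies_blk[OF that]) (use assms(1) in auto)
      then show ?thesis
        using blk_next_vals[OF that(2)] assms(1) by (simp add: val_X)
    qed
    show "holds \<sigma> i (copies K ?ab') \<longleftrightarrow> copied ?ab' w w'"
      if "blk \<sigma> i K w" "blk \<sigma> (i + K) K w'" for \<sigma> i w'
      by (rule holds_copies_blk[OF that]) (use assms(1) in auto)
    show "decides K (claim K (Suc n) f) w' (?P w')"
      if "(w' 1 < w' 2 \<and> x = e (w' 3)) \<and> copied ?ab w w'" for x w'
      by (rule F) (use that w in \<open>simp add: copied_def\<close>)
    show "decides K (claim K (Suc n) f) w' (?P w')" if "copied ?ab' w w'" for w'
      by (rule F) (use that w in \<open>simp add: copied_def\<close>)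
  qed
  moreover have "(\<exists>w'. ((w' 1 < w' 2 \<and> e a = e (w' 3)) \<and> copied ?ab w w') \<and> ?P w') \<longleftrightarrow>
      (\<exists>u>0. rec_eval f (a # args w 3 n) = Some u)" (is "?lhs \<longleftrightarrow> ?rhs") for a
  proof
    assume ?lhs
    then obtain w' where w': "w' 1 < w' 2" "a = w' 3" "copied ?ab w w'" "?P w'"
      by auto
    have "args w' 4 n = args w 3 n"
      using w'(3) by (auto simp: copied_def intro!: args_eqI)
    then show ?rhs
      using w' by (auto simp: args_Cons)
  next
    assume ?rhs
    then obtain u where u: "u > 0" "rec_eval f (a # args w 3 n) = Some u"
      by blast
    let ?w = "\<lambda>b. if b = 1 then 0 else if b = 2 then u else if b = 3 then a else w (b - 1)"
    have "args ?w 4 n = args w 3 n"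
      by (auto intro!: args_eqI)
    then show ?lhs
      using u w by (intro exI[of _ ?w]) (auto simp: args_Cons copied_def)
  qed
  moreover have "(\<exists>w'. copied ?ab' w w' \<and> ?P w') \<longleftrightarrow> rec_eval f (w 2 # args w 3 n) = Some 0"
  proof (rule ex_conj_eq)
    show "copied ?ab' w (\<lambda>b. if b < 3 then 0 else w (b - 1))"
      using w by (auto simp: copied_def)
    fix w'
    assume "copied ?ab' w w'"
    then have "args w' 4 n = args w 3 n" "w' 3 = w 2" "w' 2 = 0"
      using w by (auto simp: copied_def intro!: args_eqI)
    then show "?P w' \<longleftrightarrow> rec_eval f (w 2 # args w 3 n) = Some 0"
      by (simp add: args_Cons)
  qed
  moreover have "(\<forall>x. if m < x \<and> x < e (w 2) then A x else B) \<longleftrightarrow> (\<forall>a<w 2. A (e a)) \<and> B"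
    for A B
    by (metis above(1) less_iff aboveE less_irrefl)
  ultimately show ?thesis
    by (simp only: ex_if rec_eval_Mu_iff)
qed

lemma decides_claim:
  assumes "slots n f \<le> K" "w 1 = 0"
  shows "decides K (claim K n f) w (rec_eval f (args w 3 n) = Some (w 2))"
  using assms
proof (induction f arbitrary: n w)
  case Zero
  show ?case
    by (rule decides_local) (use Zero blk_vals(2) in auto)
next
  case Succ
  show ?case
  proof (cases "n = 1")
    case True
    let ?R = "\<lambda>x. w 3 < w 2 \<and> \<not> (e (w 3) < x \<and> x < e (w 2))"
    have "decides K (claim K n Succ) w (\<forall>x. \<exists>w'::nat \<Rightarrow> nat. ?R x \<and> True)"
      unfolding claim.simps if_P[OF True]
      by (rule decides_step[where R = "\<lambda>x _. ?R x" and P = "\<lambda>_. True"])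
        (use Succ in \<open>auto simp: holds_no_gap blk_vals decides_TT\<close>)
    \<comment> \<open>The comparison bounds slot \<open>2\<close> from below, the absence of a gap
      from above.\<close>
    moreover have "(\<forall>x. ?R x) \<longleftrightarrow> w 2 = Suc (w 3)"
      using no_value_between[of "w 3" "w 2"] by auto
    ultimately show ?thesis
      by (simp add: True args_def eq_commute)
  next
    case False
    then have "rec_eval Succ (args w 3 n) = None"
      using length_args[of w 3 n] by (auto split: list.split simp del: length_args)
    then show ?thesis
      using Succ False decides_FF[of K w] by simp
  qed
next
  case (Proj q)
  show ?case
    by (rule decides_local) (use Proj blk_vals(2) in \<open>auto simp: nth_args\<close>)
next
  case (Comp f gs)
  have "slots n g \<le> sum_list (map (slots n) gs)" if "g \<in> set gs" for g
    using that by (intro member_le_sum_list) auto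
  then have "decides K (chain K n (claim K (length gs) f) (map (claim K n) gs) 0) w
    (\<exists>zs. those (map (\<lambda>g. rec_eval g (args w 3 n)) gs) = Some zs \<and>
      rec_eval f (args w (3 + n) 0 @ zs) = Some (w 2))"
    using Comp by (intro decides_chain) (fastforce intro: le_trans)+
  then show ?case
    by (cases "those (map (\<lambda>g. rec_eval g (args w 3 n)) gs)") simp_all
next
  case (Prec f g)
  show ?case
  proof (cases n)
    case 0
    then show ?thesis using decides_FF[of K w] Prec by simp
  next
    case (Suc p)
    let ?ab = "map (\<lambda>a. (a, a)) [1..<4 + p]"
    have K: "p + 6 \<le> K" "slots p f \<le> K" "slots (Suc (Suc p)) g \<le> K"
      using Prec.prems Suc by auto
    have "decides K (claim K n (Prec f g)) w
        (\<forall>x::'d. \<exists>w'. copied ?ab w w' \<and> prec_state f g p w')"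
      unfolding claim.simps Suc nat.case
    proof (rule decides_step[where R = "\<lambda>_. copied ?ab w" and P = "prec_state f g p"])
      show "K > 0" "K > 0" using K by simp_all
      show "holds \<sigma> i (copies K ?ab) \<longleftrightarrow> copied ?ab w w'"
        if "blk \<sigma> i K w" "blk \<sigma> (i + K) K w'" for \<sigma> i w'
        by (rule holds_copies_blk[OF that]) (use K in auto)
      show "decides K (prec_loop K p (claim K p f) (claim K (Suc (Suc p)) g)) w'
          (prec_state f g p w')" if "copied ?ab w w'" for w'
        by (rule decides_prec_loop) (use K Prec that in \<open>auto simp: copied_def\<close>)
    qed
    moreover have "(\<exists>w'. copied ?ab w w' \<and> prec_state f g p w') \<longleftrightarrow>
        (\<exists>M u. prec_ok f g (w 2) (w 3) (args w 4 p) M u)" (is "?lhs \<longleftrightarrow> ?rhs")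
    proof
      assume ?lhs
      then obtain w' where w': "copied ?ab w w'" "prec_state f g p w'"
        by blast
      have "args w' 4 p = args w 4 p" "w' 2 = w 2" "w' 3 = w 3"
        using w'(1) by (auto simp: copied_def intro!: args_eqI)
      then show ?rhs
        using w'(2) by (auto simp: prec_state_def)
    next
      assume ?rhs
      then obtain M u where ok: "prec_ok f g (w 2) (w 3) (args w 4 p) M u"
        by blast
      let ?w = "w(4 + p := M, 5 + p := u)"
      have "args ?w 4 p = args w 4 p"
        by (auto intro!: args_eqI)
      then have "prec_state f g p ?w"
        using ok by (simp add: prec_state_def)
      moreover have "copied ?ab w ?w"
        by (auto simp: copied_def)
      ultimately show ?lhs by blast
    qed
    ultimately show ?thesis
      by (simp only: ex_prec_ok Suc args_Cons simp_thms) simp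
  qed
next
  case (Mu f)
  then show ?case
    by (intro decides_mu) auto
qed

end

section \<open>Setting up the input\<close>

text \<open>The input \<open>t\<close> of a program is produced in blocks of length \<open>4\<close>, which hold \<open>0\<close>, the current
  value and a guess of its successor. This way the length of the formula grows by a constant when
  \<open>t\<close> is incremented, independently of the length of the blocks of the program.\<close>

definition ramp_step :: "formula \<Rightarrow> formula" where
  "ramp_step =
    step 4 4 (Conj (Conj (lt (Y 2) (Y 3)) (no_gap 4 2 3)) (copies 4 [(1, 1), (3, 2)]))"

text \<open>Only here is it checked that slot \<open>1\<close> holds \<open>0\<close>: nothing lies
  between it and the marker. It then serves as the claimed result, and the current value of the ramp
  as the argument.\<close>

definition launch :: "recf \<Rightarrow> formula" where
  "launch f =
    step 4 (4 + slots 1 f) (Conj (no_gap 4 0 1) (copies 4 [(1, 1), (1, 2), (2, 3)]))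
      (claim (4 + slots 1 f) 1 f)"

text \<open>The ramp counts from the number in slot \<open>1\<close>, which \<open>launch\<close>
  later forces to be \<open>0\<close>.\<close>

definition first_block :: formula where
  "first_block = Conjs [lt (Y 0) (Y 1), eq (Y 1) (Y 2), lt (Y 0) (Y 3)]"

definition input_claim :: "nat \<Rightarrow> formula \<Rightarrow> formula" where
  "input_claim t \<phi> = Conj first_block ((ramp_step ^^ t) \<phi>)"

context blocks
begin

text \<open>Each increment can be challenged in the first round after the block that guesses the
  successor. For \<open>t = 0\<close> no increment follows and slot \<open>3\<close> is
  unconstrained.\<close>

lemma decides_ramp:
  assumes "\<And>w. decides 4 \<phi> w (P (w 1) (w 2))"
  shows "decides 4 ((ramp_step ^^ t) \<phi>) w ((t > 0 \<longrightarrow> w 3 = Suc (w 2)) \<and> P (w 1) (w 2 + t))"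
proof (induction t arbitrary: w)
  case 0
  then show ?case using assms by simp
next
  case (Suc t)
  let ?ab = "[(1, 1), (3, 2)] :: (nat \<times> nat) list"
  let ?gap = "\<lambda>x. e (w 2) < x \<and> x < e (w 3)"
  let ?Q = "\<lambda>w. (t > 0 \<longrightarrow> w 3 = Suc (w 2)) \<and> P (w 1) (w 2 + t)"
  have "decides 4 ((ramp_step ^^ Suc t) \<phi>) w
      (\<forall>x. \<exists>w'. ((w 2 < w 3 \<and> \<not> ?gap x) \<and> copied ?ab w w') \<and> ?Q w')"
    unfolding funpow.simps o_apply ramp_step_def[THEN fun_cong]
  proof (rule decides_step[where R = "\<lambda>x w'. (w 2 < w 3 \<and> \<not> ?gap x) \<and> copied ?ab w w'"
        and P = ?Q])
    show "holds \<sigma> i (Conj (Conj (lt (Y 2) (Y 3)) (no_gap 4 2 3)) (copies 4 ?ab)) \<longleftrightarrow>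
        (w 2 < w 3 \<and> \<not> ?gap (fst (\<sigma> (i + 4)))) \<and> copied ?ab w w'"
      if "blk \<sigma> i 4 w" "blk \<sigma> (i + 4) 4 w'" for \<sigma> i w'
      using holds_copies_blk[OF that, of ?ab] blk_vals[OF that(1)] by (simp add: holds_no_gap)
    show "decides 4 ((step 4 4 (Conj (Conj (lt (Y 2) (Y 3)) (no_gap 4 2 3)) (copies 4 ?ab)) ^^ t) \<phi>)
        w' (?Q w')" for w'
      using Suc.IH[of w'] unfolding ramp_step_def .
  qed simp_all
  moreover have "(\<exists>w'. copied ?ab w w' \<and> ?Q w') \<longleftrightarrow> P (w 1) (w 3 + t)"
  proof
    assume "P (w 1) (w 3 + t)"
    then show "\<exists>w'. copied ?ab w w' \<and> ?Q w'"
      by (intro exI[of _ "w(2 := w 3, 3 := Suc (w 3))"]) (simp add: copied_def)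
  qed (auto simp: copied_def)
  moreover have "(\<forall>x. \<exists>w'. ((w 2 < w 3 \<and> \<not> ?gap x) \<and> copied ?ab w w') \<and> ?Q w') \<longleftrightarrow>
      w 2 < w 3 \<and> (\<forall>x. \<not> ?gap x) \<and> (\<exists>w'. copied ?ab w w' \<and> ?Q w')"
    by blast
  moreover have "w 2 < w 3 \<and> w 3 \<le> Suc (w 2) \<and> P (w 1) (w 3 + t) \<longleftrightarrow>
      (Suc t > 0 \<longrightarrow> w 3 = Suc (w 2)) \<and> P (w 1) (w 2 + Suc t)"
    by (cases "w 3 = Suc (w 2)") auto
  ultimately show ?case
    by (simp only: no_value_between)
qed

lemma decides_launch: "decides 4 (launch f) w (w 1 = 0 \<and> rec_eval f [w 2] = Some 0)"
proof (cases "w 1 = 0")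
  case True
  let ?K = "4 + slots 1 f"
  let ?ab = "[(1, 1), (1, 2), (2, 3)] :: (nat \<times> nat) list"
  let ?gap = "\<lambda>x. m < x \<and> x < e (w 1)"
  let ?P = "\<lambda>w. rec_eval f (args w 3 1) = Some (w 2)"
  have "decides 4 (launch f) w (\<forall>x. \<exists>w'. (\<not> ?gap x \<and> copied ?ab w w') \<and> ?P w')"
    unfolding launch_def
  proof (rule decides_step[where R = "\<lambda>x w'. \<not> ?gap x \<and> copied ?ab w w'" and P = ?P])
    show "holds \<sigma> i (Conj (no_gap 4 0 1) (copies 4 ?ab)) \<longleftrightarrow>
        \<not> ?gap (fst (\<sigma> (i + 4))) \<and> copied ?ab w w'"
      if "blk \<sigma> i 4 w" "blk \<sigma> (i + 4) ?K w'" for \<sigma> i w'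
      using holds_copies_blk[OF that, of ?ab] blk_vals[OF that(1)] by (simp add: holds_no_gap)
    show "decides ?K (claim ?K 1 f) w' (?P w')" if "\<not> ?gap x \<and> copied ?ab w w'" for x w'
      by (rule decides_claim) (use that True in \<open>simp_all add: copied_def\<close>)
  qed simp_all
  moreover have "(\<exists>w'. copied ?ab w w' \<and> ?P w') \<longleftrightarrow> rec_eval f [w 2] = Some 0"
  proof (rule ex_conj_eq)
    show "copied ?ab w (\<lambda>b. if b = 3 then w 2 else 0)"
      using True by (simp add: copied_def)
    show "?P w' \<longleftrightarrow> rec_eval f [w 2] = Some 0" if "copied ?ab w w'" for w'
      using that True by (simp add: copied_def args_def)
  qed
  moreover have "\<not> ?gap x" for x
    using True by (auto elim: aboveE)
  ultimately show ?thesis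
    using True by simp
next
  case False
  \<comment> \<open>The move \<open>e 0\<close> lies strictly between the marker and a slot
    \<open>1\<close> that does not hold \<open>0\<close>.\<close>
  have "decides 4 (launch f) w False"
  proof (rule decides_refuted)
    show "\<not> holds \<sigma> i (launch f)" if "blk \<sigma> i 4 w" "fst (\<sigma> (i + 4)) = e 0" for \<sigma> i
      using that False blk_vals[OF that(1)] by (simp add: launch_def holds_step holds_no_gap)
  qed simp
  then show ?thesis using False by simp
qed

end

lemma all_slots_4: "(\<forall>j::nat. 0 < j \<and> j < 4 \<longrightarrow> P j) \<longleftrightarrow> P 1 \<and> P 2 \<and> P 3"
proof -
  have "0 < j \<and> j < 4 \<longleftrightarrow> j = 1 \<or> j = 2 \<or> j = 3" for j :: nat
    by arith
  then show ?thesis by auto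
qed

text \<open>The domain enters only through \<open>disc\<close>: above each element the order is that
  of the natural numbers. The marker is the system's first value, so \<open>e\<close> is known only
  once the first block is played.\<close>

lemma win_input_claim:
  assumes disc: "\<And>m::'d::linorder. \<exists>e. blocks m e"
  shows "win (\<lambda>\<sigma>::nat \<Rightarrow> 'd \<times> 'd. holds \<sigma> 0 (input_claim t (launch f))) [] \<longleftrightarrow>
    rec_eval f [t] = Some 0"
proof -
  let ?\<phi> = "(ramp_step ^^ t) (launch f)"
  let ?P = "\<lambda>w::nat \<Rightarrow> nat. (t > 0 \<longrightarrow> w 3 = Suc (w 2)) \<and> w 1 = 0 \<and> rec_eval f [w 2 + t] = Some 0"
  define fits where "fits ys e w \<longleftrightarrow> blocks (ys ! 0) e \<and>
      (\<forall>j. 0 < j \<and> j < 4 \<longrightarrow> ys ! j = e (w j)) \<and> w 1 = w 2"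
    for ys :: "'d list" and e and w :: "nat \<Rightarrow> nat"
  have "win (\<lambda>\<sigma>::nat \<Rightarrow> 'd \<times> 'd. holds \<sigma> 0 (input_claim t (launch f))) [] \<longleftrightarrow>
      (\<forall>x::'d. \<exists>ys. length ys = 4 \<and> (\<exists>e w. fits ys e w \<and> ?P w))"
  proof (rule win_rounds)
    fix xs ys :: "'d list"
    assume len: "length xs = 4" "length ys = 4"
    let ?h = "zip xs ys"
    have vals: "val \<sigma> 0 (Y j) = ys ! j" if "map \<sigma> [0..<length ?h] = ?h" "j < 4" for \<sigma> j
    proof -
      have "\<sigma> j = ?h ! j"
        using that len by (metis add_0 diff_zero length_zip min.idem nth_map_upt)
      then show ?thesis
        using that(2) len by (simp add: val_Y)
    qed
    have first_block: "holds \<sigma> 0 first_block \<longleftrightarrow> ys ! 0 < ys ! 1 \<and> ys ! 1 = ys ! 2 \<and> ys ! 0 < ys ! 3"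
      if "map \<sigma> [0..<length ?h] = ?h" for \<sigma>
      using vals[OF that] by (simp add: first_block_def)
    show "win (\<lambda>\<sigma>. holds \<sigma> 0 (input_claim t (launch f))) ([] @ ?h) \<longleftrightarrow>
        (\<exists>e w. fits ys e w \<and> ?P w)"
    proof (cases "\<exists>e w. fits ys e w")
      case True
      have "win (\<lambda>\<sigma>. holds \<sigma> 0 (input_claim t (launch f))) ?h \<longleftrightarrow> ?P w" if fits: "fits ys e w" for e w
      proof -
        interpret blocks "ys ! 0" e using fits by (simp add: fits_def)
        have ys: "ys ! 1 = e (w 1)" "ys ! 2 = e (w 2)" "ys ! 3 = e (w 3)"
          using fits by (simp_all add: fits_def)
        have "win (\<lambda>\<sigma>. holds \<sigma> 0 (input_claim t (launch f))) ?h \<longleftrightarrow> win (\<lambda>\<sigma>. holds \<sigma> 0 ?\<phi>) ?h"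
          by (rule win_cong) (use first_block fits ys in \<open>simp add: input_claim_def fits_def\<close>)
        also have "\<dots> \<longleftrightarrow> ?P w"
        proof -
          have "decides 4 ?\<phi> w (?P w)"
            by (rule decides_ramp[where P = "\<lambda>a b. a = 0 \<and> rec_eval f [b] = Some 0"])
              (rule decides_launch)
          moreover have "blk ((!) ?h) 0 4 w" "length ?h = 0 + 4"
            using fits len by (simp_all add: blk_def fits_def)
          ultimately show ?thesis
            unfolding decides_def by blast
        qed
        finally show ?thesis .
      qed
      note win = this
      obtain e w where fits: "fits ys e w"
        using True by blast
      show ?thesis
        unfolding append_Nil
      proof
        assume "win (\<lambda>\<sigma>. holds \<sigma> 0 (input_claim t (launch f))) ?h"
        then have "?P w"
          unfolding win[OF fits] .
        with fits show "\<exists>e w. fits ys e w \<and> ?P w" by blast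
      next
        assume "\<exists>e w. fits ys e w \<and> ?P w"
        then obtain e w where fits: "fits ys e w" and "?P w" by blast
        then show "win (\<lambda>\<sigma>. holds \<sigma> 0 (input_claim t (launch f))) ?h"
          unfolding win[OF fits] by blast
      qed
    next
      case False
      have "\<not> holds \<sigma> 0 first_block" if "map \<sigma> [0..<length ?h] = ?h" for \<sigma>
      proof
        assume "holds \<sigma> 0 first_block"
        then have ys: "ys ! 0 < ys ! 1" "ys ! 1 = ys ! 2" "ys ! 0 < ys ! 3"
          using first_block[OF that] by blast+
        obtain e where e: "blocks (ys ! 0) e"
          using disc by blast
        obtain a b where "ys ! 1 = e a" "ys ! 3 = e b"
          using blocks.aboveE[OF e] ys by metis
        then have "fits ys e (\<lambda>j. if j = 3 then b else a)"
          using e ys by (simp add: fits_def all_slots_4)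
        with False show False by blast
      qed
      then have "win (\<lambda>\<sigma>. holds \<sigma> 0 (input_claim t (launch f))) ?h \<longleftrightarrow> win (\<lambda>_. False) ?h"
        by (intro win_cong) (simp add: input_claim_def)
      then show ?thesis
        using False by (auto simp: win_const)
    qed
  qed simp
  also have "\<dots> \<longleftrightarrow> rec_eval f [t] = Some 0"
  proof
    assume f: "rec_eval f [t] = Some 0"
    obtain e where e: "blocks (undefined :: 'd) e"
      using disc by blast
    \<comment> \<open>Any element can be the marker. Slot \<open>3\<close> holds \<open>1\<close>,
      the successor that is required if \<open>t > 0\<close>.\<close>
    let ?ys = "[undefined, e 0, e 0, e 1]" and ?w = "\<lambda>j::nat. if j = 3 then 1 else 0 :: nat"
    have "length ?ys = 4" "fits ?ys e ?w \<and> ?P ?w"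
      using e f by (simp_all add: fits_def all_slots_4 numeral_2_eq_2 numeral_3_eq_3)
    then show "\<forall>x::'d. \<exists>ys. length ys = 4 \<and> (\<exists>e w. fits ys e w \<and> ?P w)"
      by blast
  next
    assume "\<forall>x::'d. \<exists>ys. length ys = 4 \<and> (\<exists>e w. fits ys e w \<and> ?P w)"
    then obtain w :: "nat \<Rightarrow> nat" where "w 2 = 0" "rec_eval f [w 2 + t] = Some 0"
      unfolding fits_def by metis
    then show "rec_eval f [t] = Some 0" by simp
  qed
  finally show ?thesis .
qed

section \<open>Games and codes\<close>

definition game :: "formula \<Rightarrow> (order_symbol, nat) cltl_game" where
  "game \<phi> = \<lparr> sys_vars = {1}, env_vars = {0}, lookahead_vars = {0, 1}, blind_vars = {}, goal = \<phi> \<rparr>"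

definition assign :: "'d \<times> 'd \<Rightarrow> nat \<rightharpoonup> 'd" where
  "assign = (\<lambda>(x, y). [0 \<mapsto> x, 1 \<mapsto> y])"

definition unassign :: "(nat \<rightharpoonup> 'd) \<Rightarrow> 'd \<times> 'd" where
  "unassign v = (the (v 0), the (v 1))"

lemma unassign_assign [simp]: "unassign (assign p) = p"
  by (simp add: unassign_def assign_def split: prod.split)

lemma model_eq_assign: "model \<sigma> = (\<lambda>i. assign (\<sigma> i))"
  by (simp add: fun_eq_iff model_def assign_def split: prod.split)

lemma dom_singleton: "dom v = {a} \<Longrightarrow> v = [a \<mapsto> the (v a)]"
  by (rule ext) (metis domIff fun_upd_apply insertI1 option.collapse singletonD)

text \<open>A partial map on a single variable is determined by its value, so strategies on
  assignments and strategies on pairs correspond.\<close>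

lemma realizable_game:
  "realizable (order_system :: (order_symbol, 'd::linorder) constraint_system) (game \<phi>) \<longleftrightarrow>
    win (\<lambda>\<sigma>::nat \<Rightarrow> 'd \<times> 'd. holds \<sigma> 0 \<phi>) []"
proof
  assume "realizable (order_system :: (order_symbol, 'd) constraint_system) (game \<phi>)"
  then obtain s :: "(nat, 'd) strategy" where s: "system_strategy (game \<phi>) s"
    and sat: "\<And>\<sigma>. consistent (game \<phi>) s \<sigma> \<Longrightarrow> sat order_system \<sigma> 0 \<phi>"
    unfolding realizable_def game_def by auto
  show "win (\<lambda>\<sigma>::nat \<Rightarrow> 'd \<times> 'd. holds \<sigma> 0 \<phi>) []"
    unfolding win_def
  proof (intro exI allI impI)
    fix \<sigma> :: "nat \<Rightarrow> 'd \<times> 'd"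
    assume fol: "follows (\<lambda>h x. the (s (map assign h) [0 \<mapsto> x] 1)) (length ([] :: ('d \<times> 'd) list)) \<sigma>"
    have "consistent (game \<phi>) s (model \<sigma>)"
      unfolding consistent_def
    proof (intro exI allI conjI)
      fix i
      show "dom [0 \<mapsto> fst (\<sigma> i)] = env_vars (game \<phi>)"
        by (simp add: game_def)
      let ?r = "s (map (model \<sigma>) [0..<i]) [0 \<mapsto> fst (\<sigma> i)]"
      have "dom ?r = {1}"
      proof -
        have "\<forall>v\<in>set (map (model \<sigma>) [0..<i]). dom v = sys_vars (game \<phi>) \<union> env_vars (game \<phi>)"
          "dom [0 \<mapsto> fst (\<sigma> i)] = env_vars (game \<phi>)"
          by (auto simp: game_def model_def)
        then have "dom ?r = sys_vars (game \<phi>)"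
          using s unfolding system_strategy_def by blast
        then show ?thesis by (simp add: game_def)
      qed
      then have "?r = [1 \<mapsto> the (?r 1)]"
        by (rule dom_singleton)
      moreover have "the (?r 1) = snd (\<sigma> i)"
        using fol by (simp add: follows_def comp_def model_eq_assign)
      ultimately have "?r = [1 \<mapsto> snd (\<sigma> i)]" by simp
      then show "model \<sigma> i = [0 \<mapsto> fst (\<sigma> i)] ++ ?r"
        by (simp add: model_def)
    qed
    then show "holds \<sigma> 0 \<phi>"
      using sat by (simp add: holds_def)
  qed
next
  assume "win (\<lambda>\<sigma>::nat \<Rightarrow> 'd \<times> 'd. holds \<sigma> 0 \<phi>) []"
  then obtain S where S: "\<And>\<sigma> :: nat \<Rightarrow> 'd \<times> 'd. follows S 0 \<sigma> \<Longrightarrow> holds \<sigma> 0 \<phi>"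
    unfolding win_def by auto
  define s :: "(nat, 'd) strategy" where "s h em = [1 \<mapsto> S (map unassign h) (the (em 0))]" for h em
  have "sat order_system \<sigma> 0 \<phi>" if "consistent (game \<phi>) s \<sigma>" for \<sigma>
  proof -
    obtain em where em: "\<And>i. dom (em i) = {0}" "\<And>i. \<sigma> i = em i ++ s (map \<sigma> [0..<i]) (em i)"
      using \<open>consistent (game \<phi>) s \<sigma>\<close> unfolding consistent_def game_def by auto
    have \<sigma>: "\<sigma> i = [0 \<mapsto> the (em i 0), 1 \<mapsto> S (map unassign (map \<sigma> [0..<i])) (the (em i 0))]" for i
      by (subst em(2), subst dom_singleton[OF em(1)]) (simp add: s_def)
    let ?\<sigma> = "\<lambda>i. unassign (\<sigma> i)"
    have u: "unassign (\<sigma> i) = (the (em i 0), S (map unassign (map \<sigma> [0..<i])) (the (em i 0)))" for i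
      by (subst \<sigma>) (simp add: unassign_def)
    have "snd (unassign (\<sigma> i)) = S (map ?\<sigma> [0..<i]) (fst (unassign (\<sigma> i)))" for i
      using u[of i] by (simp add: comp_def)
    then have "follows S 0 ?\<sigma>"
      by (simp add: follows_def)
    moreover have "model ?\<sigma> = \<sigma>"
    proof
      show "model ?\<sigma> i = \<sigma> i" for i
        by (simp only: model_def u[of i] fst_conv snd_conv \<sigma>[of i, symmetric])
    qed
    ultimately show ?thesis
      using S[of ?\<sigma>] by (simp add: holds_def)
  qed
  moreover have "system_strategy (game \<phi>) s"
    by (simp add: system_strategy_def game_def s_def)
  ultimately show "realizable (order_system :: (order_symbol, 'd) constraint_system) (game \<phi>)"
    unfolding realizable_def by (auto simp: game_def)
qed

section \<open>Well-formedness of the constructed formulas\<close>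

lemma wf_cltl_cong: "arity \<D> = arity \<E> \<Longrightarrow> wf_cltl \<D> Va Vb \<phi> \<longleftrightarrow> wf_cltl \<E> Va Vb \<phi>"
  by (induction \<phi>) simp_all

text \<open>Well-formedness depends on the domain only through the arities, so it is shown for one
  domain and transferred by \<open>wf_cltl_cong\<close>.\<close>

definition wf_formula :: "formula \<Rightarrow> bool" where
  "wf_formula = wf_cltl (order_system :: (order_symbol, nat) constraint_system) {0, 1} {}"

lemma wf_simps [simp]:
  "wf_formula (lt s t) \<longleftrightarrow> snd s \<in> {0, 1} \<and> snd t \<in> {0, 1}"
  "wf_formula (eq s t) \<longleftrightarrow> snd s \<in> {0, 1} \<and> snd t \<in> {0, 1}"
  "snd (X j) = 0" "snd (Y j) = 1" "snd (YN L j) = 1"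
  "wf_formula (Neg \<phi>) \<longleftrightarrow> wf_formula \<phi>" "wf_formula (Or \<phi> \<psi>) \<longleftrightarrow> wf_formula \<phi> \<and> wf_formula \<psi>"
  "wf_formula (Next \<phi>) \<longleftrightarrow> wf_formula \<phi>" "wf_formula (Until \<phi> \<psi>) \<longleftrightarrow> wf_formula \<phi> \<and> wf_formula \<psi>"
  by (auto simp: wf_formula_def lt_def eq_def order_system_def X_def Y_def YN_def)

lemma wf_boolean [simp]:
  "wf_formula TT" "wf_formula FF"
  "wf_formula (Conj \<phi> \<psi>) \<longleftrightarrow> wf_formula \<phi> \<and> wf_formula \<psi>"
  "wf_formula (Ite b \<phi> \<psi>) \<longleftrightarrow> wf_formula b \<and> wf_formula \<phi> \<and> wf_formula \<psi>"
  by (auto simp: TT_def FF_def Conj_def Ite_def)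

lemma wf_Conjs [simp]: "wf_formula (Conjs \<phi>s) \<longleftrightarrow> (\<forall>\<phi>\<in>set \<phi>s. wf_formula \<phi>)"
  by (induction \<phi>s) (auto simp: Conjs_def)

lemma wf_NextN [simp]: "wf_formula ((Next ^^ k) \<phi>) \<longleftrightarrow> wf_formula \<phi>"
  by (induction k) auto

lemma wf_step [simp]:
  "wf_formula (step L L' c \<psi>) \<longleftrightarrow> wf_formula c \<and> wf_formula \<psi>"
  "wf_formula (copies L ab)" "wf_formula (no_gap L a b)" "wf_formula (start L)"
  by (auto simp: step_def copies_def no_gap_def start_def)

lemma wf_chain:
  "wf_formula F \<Longrightarrow> \<forall>G\<in>set Gs. wf_formula G \<Longrightarrow> wf_formula (chain K n F Gs j)"
  by (induction Gs arbitrary: j) auto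

lemma wf_claim: "wf_formula (claim K n f)"
  by (induction K n f rule: claim.induct)
    (auto simp: wf_chain prec_loop_def prec_base_def prec_check_def prec_descend_def split: nat.split)

lemma wf_input_claim: "wf_formula (input_claim t (launch f))"
  by (induction t) (auto simp: input_claim_def first_block_def ramp_step_def launch_def wf_claim)

lemma restricted_game:
  "restricted_game (order_system :: (order_symbol, 'd::linorder) constraint_system)
    (game (input_claim t (launch f)))"
proof -
  have "wf_cltl (order_system :: (order_symbol, 'd) constraint_system) {0, 1} {}
      (input_claim t (launch f))"
    using wf_input_claim[of t f] unfolding wf_formula_def
    by (subst wf_cltl_cong[of _ "order_system :: (order_symbol, nat) constraint_system"])
      (simp_all add: order_system_def)
  then show ?thesis
    unfolding restricted_game_def wf_game_def game_def by auto
qed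

section \<open>Recursive functions that compute codes\<close>

definition rconst :: "nat \<Rightarrow> recf" where
  "rconst c = ((\<lambda>f. Comp Succ [f]) ^^ c) Zero"

lemma rec_eval_const [simp]: "rec_eval (rconst c) xs = Some c"
  by (induction c) (simp_all add: rconst_def)

definition radd :: recf where
  "radd = Prec (Proj 0) (Comp Succ [Proj 1])"

lemma rec_eval_add [simp]: "rec_eval radd [a, b] = Some (a + b)"
  by (induction a) (simp_all add: radd_def)

definition rtriangle :: recf where
  "rtriangle = Prec Zero (Comp Succ [Comp radd [Proj 0, Proj 1]])"

lemma rec_eval_triangle [simp]: "rec_eval rtriangle [a] = Some (triangle a)"
  by (induction a) (simp_all add: rtriangle_def)

text \<open>Follows \<open>prod_encode (a, b) = triangle (a + b) + a\<close>.\<close>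

definition rpair :: "recf \<Rightarrow> recf \<Rightarrow> recf" where
  "rpair f g = Comp radd [Comp rtriangle [Comp radd [f, g]], f]"

lemma rec_eval_pair [simp]:
  "rec_eval f xs = Some a \<Longrightarrow> rec_eval g xs = Some b \<Longrightarrow>
    rec_eval (rpair f g) xs = Some (prod_encode (a, b))"
  by (simp add: rpair_def prod_encode_def)

definition rneg :: "recf \<Rightarrow> recf" where
  "rneg f = rpair (rconst 2) f"

text \<open>The first conjunct is a fixed formula whose code enters as a constant; only the second
  is computed.\<close>

definition rconj :: "formula \<Rightarrow> recf \<Rightarrow> recf" where
  "rconj \<phi> f = rneg (rpair (rconst 3) (rpair (rconst (encode_cltl (Neg \<phi>))) (rneg f)))"

lemma rec_eval_neg [simp]:
  "rec_eval f xs = Some (encode_cltl \<phi>) \<Longrightarrow> rec_eval (rneg f) xs = Some (encode_cltl (Neg \<phi>))"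
  by (simp add: rneg_def)

lemma rec_eval_conj:
  assumes "rec_eval f xs = Some (encode_cltl \<psi>)"
  shows "rec_eval (rconj \<phi> f) xs = Some (encode_cltl (Conj \<phi> \<psi>))"
  unfolding rconj_def Conj_def by (rule rec_eval_neg) (use assms in simp)

definition rnext :: "recf \<Rightarrow> recf" where
  "rnext f = rpair (rconst 4) f"

lemma rec_eval_nexts:
  "rec_eval f xs = Some (encode_cltl \<phi>) \<Longrightarrow>
    rec_eval ((rnext ^^ k) f) xs = Some (encode_cltl ((Next ^^ k) \<phi>))"
  by (induction k) (simp_all add: rnext_def)

lemma ex_rec_step:
  "\<exists>r. \<forall>f xs \<psi>. rec_eval f xs = Some (encode_cltl \<psi>) \<longrightarrow>
    rec_eval (r f) xs = Some (encode_cltl (step L L' c \<psi>))"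
proof (intro exI allI impI)
  let ?next = "Conjs (eq (Y 0) (YN L 0) # map (\<lambda>j. lt (Y 0) (YN L j)) [1..<L'])"
  fix f xs \<psi>
  assume "rec_eval f xs = Some (encode_cltl \<psi>)"
  then show "rec_eval (rconj ?next (rconj c ((rnext ^^ L) f))) xs =
      Some (encode_cltl (step L L' c \<psi>))"
    unfolding step_def by (intro rec_eval_conj rec_eval_nexts)
qed

text \<open>Every stage prefixes the same fixed formula, so the iteration is a primitive recursion
  on codes. Using the code itself as the number of stages prepares the diagonal argument.\<close>

lemma ex_rec_ramp:
  "\<exists>r. \<forall>\<phi>. rec_eval r [encode_cltl \<phi>] =
    Some (encode_cltl ((ramp_step ^^ encode_cltl \<phi>) \<phi>))"
proof -
  obtain r where r: "\<And>f xs \<psi>. rec_eval f xs = Some (encode_cltl \<psi>) \<Longrightarrow>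
      rec_eval (r f) xs = Some (encode_cltl (ramp_step \<psi>))"
    unfolding ramp_step_def using ex_rec_step by blast
  let ?p = "Prec (Proj 0) (r (Proj 1))"
  have "rec_eval ?p [t, encode_cltl \<phi>] = Some (encode_cltl ((ramp_step ^^ t) \<phi>))" for t \<phi>
  proof (induction t)
    case (Suc t)
    have "rec_eval (r (Proj 1)) [t, encode_cltl ((ramp_step ^^ t) \<phi>), encode_cltl \<phi>] =
        Some (encode_cltl (ramp_step ((ramp_step ^^ t) \<phi>)))"
      by (rule r) simp
    then show ?case
      using Suc by simp
  qed simp
  then have "rec_eval (Comp ?p [Proj 0, Proj 0]) [encode_cltl \<phi>] =
      Some (encode_cltl ((ramp_step ^^ encode_cltl \<phi>) \<phi>))" for \<phi>
    by simp
  then show ?thesis by blast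
qed

lemma ex_rec_game:
  "\<exists>r. \<forall>\<phi>. rec_eval r [encode_cltl \<phi>] =
    Some (encode_game (game (input_claim (encode_cltl \<phi>) \<phi>)))"
proof -
  obtain r where r: "\<And>\<phi>. rec_eval r [encode_cltl \<phi>] =
      Some (encode_cltl ((ramp_step ^^ encode_cltl \<phi>) \<phi>))"
    using ex_rec_ramp by blast
  \<comment> \<open>The code of a nonempty list is the successor of a pair.\<close>
  define rcons where "rcons f g = Comp Succ [rpair f g]" for f g
  have rcons: "rec_eval (rcons f g) xs = Some (list_encode (a # as))"
    if "rec_eval f xs = Some a" "rec_eval g xs = Some (list_encode as)" for f g xs a as
    using rec_eval_pair[OF that] by (simp add: rcons_def)
  let ?r = "rcons (rconst (set_encode {1})) (rcons (rconst (set_encode {0}))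
      (rcons (rconst (set_encode {0, 1})) (rcons (rconst (set_encode {}))
      (rcons (rconj first_block r) (rconst (list_encode []))))))"
  have "rec_eval ?r [encode_cltl \<phi>] =
      Some (encode_game (game (input_claim (encode_cltl \<phi>) \<phi>)))" for \<phi>
    unfolding encode_game_def game_def input_claim_def cltl_game.select_convs
    by (intro rcons rec_eval_const rec_eval_conj r)
  then show ?thesis by blast
qed

section \<open>Diagonalisation and the two domains\<close>

lemma undecidable:
  assumes "\<And>m::'d::linorder. \<exists>e. blocks m e"
  shows "\<not> decidable_on encode_game
      (restricted_game (order_system :: (order_symbol, 'd) constraint_system))
      (realizable (order_system :: (order_symbol, 'd) constraint_system))"
proof
  assume "decidable_on encode_game
      (restricted_game (order_system :: (order_symbol, 'd) constraint_system))
      (realizable (order_system :: (order_symbol, 'd) constraint_system))"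
  then obtain d where d: "\<And>G. restricted_game (order_system :: (order_symbol, 'd) constraint_system) G \<Longrightarrow>
      rec_eval d [encode_game G] =
        Some (if realizable (order_system :: (order_symbol, 'd) constraint_system) G then 1 else 0)"
    unfolding decidable_on_def by blast
  obtain r where r: "\<And>\<phi>. rec_eval r [encode_cltl \<phi>] =
      Some (encode_game (game (input_claim (encode_cltl \<phi>) \<phi>)))"
    using ex_rec_game by blast
  \<comment> \<open>\<open>r\<close> turns the code of \<open>launch f\<close> into the game
    claiming that \<open>f\<close> returns \<open>0\<close> on this code, and \<open>d\<close> tells
    whether the claim is won. There is no circularity: \<open>?f\<close> comes first and its claim
    formula then supplies the input \<open>?t\<close>.\<close>
  let ?f = "Comp d [r]"
  let ?t = "encode_cltl (launch ?f)"
  let ?G = "game (input_claim ?t (launch ?f))"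
  have "rec_eval ?f [?t] = rec_eval d [encode_game ?G]"
    using r[of "launch ?f"] by simp
  \<comment> \<open>The system wins exactly if \<open>?f\<close> returns \<open>0\<close> on
    \<open>?t\<close>, and then \<open>d\<close> makes \<open>?f\<close> return
    \<open>1\<close>.\<close>
  also have "\<dots> = Some (if rec_eval ?f [?t] = Some 0 then 1 else 0)"
    by (simp only: d[OF restricted_game] realizable_game win_input_claim[OF assms])
  finally show False
    by (auto split: if_splits)
qed

lemma blocks_int: "blocks m (\<lambda>c. m + 1 + int c)"
proof
  show "range (\<lambda>c. m + 1 + int c) = {m<..}"
  proof (intro equalityI subsetI)
    fix x
    assume "x \<in> {m<..}"
    then have "x = m + 1 + int (nat (x - m - 1))" by simp
    then show "x \<in> range (\<lambda>c. m + 1 + int c)" by blast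
  qed auto
qed (simp add: strict_mono_def)

lemma blocks_nat: "blocks m (\<lambda>c. m + 1 + c)" for m :: nat
proof
  show "range (\<lambda>c. m + 1 + c) = {m<..}"
  proof (intro equalityI subsetI)
    fix x
    assume "x \<in> {m<..}"
    then have "x = m + 1 + (x - m - 1)" by simp
    then show "x \<in> range (\<lambda>c. m + 1 + c)" by blast
  qed auto
qed (simp add: strict_mono_def)

theorem theorem1:
  shows "\<not> decidable_on encode_game
      (restricted_game (order_system :: (order_symbol, int) constraint_system))
      (realizable (order_system :: (order_symbol, int) constraint_system)) \<and>
    \<not> decidable_on encode_game
      (restricted_game (order_system :: (order_symbol, nat) constraint_system))
      (realizable (order_system :: (order_symbol, nat) constraint_system))"
  by (intro conjI undecidable; rule exI, rule blocks_int blocks_nat)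

end
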